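(* Let $f:\mathcal{X}\times\mathcal{Y}\to[-1,1]$ realize a matrix $A\in[-1,1]^{k\times k}$. Then for every integer $1\le t\le\mathrm{rank}(A)$, \[\bar{\mathrm{R}}_\varepsilon(f)\ge\Omega\!\left(\min\!\left(t,\ \frac{t^2}{\varepsilon^2k^2\lambda_t(A)^2}\right)\right).\]
   Context: $f$ realizes $A$ if there exist $x_1,\dots,x_k\in\mathcal{X}$ and $y_1,\dots,y_k\in\mathcal{Y}$ with $A_{ij}=f(x_i,y_j)$ for all $i,j\in[k]$. For $t\le\mathrm{rank}(A)$, $\lambda_t(A)=\sum_{i=1}^t 1/\sigma_i$, where $\sigma_1\ge\sigma_2\ge\cdots$ are the singular values of $A$. Distributed estimation: Alice holds a probability distribution $p$ on $\mathcal{X}$, Bob a probability distribution $q$ on $\mathcal{Y}$, and they must output an estimate within additive error $\varepsilon$ of $\mathbb{E}_{x\sim p,y\sim q}[f(x,y)]$. $\bar{\mathrm{R}}_\varepsilon(f)$ is the minimum worst-case communication of a shared-randomness randomized protocol succeeding with probability at least $2/3$ on every input pair. $\Omega$ hides an absolute constant.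
   Formalization: The bound is proved for max(1, R) instead of R, since a constant f has R = 0 while the minimum is positive; ε > 0 is assumed; the absolute constant is stated per ambient types of X and Y, but the one for the natural numbers serves all by restricting f to the points realizing A. *)

theory Defs
  imports
    "HOL-Probability.Probability_Mass_Function"
    "HOL-Library.Extended_Nat"
    "HOL-Library.Extended_Real"
    "Jordan_Normal_Form.Char_Poly"
    "Jordan_Normal_Form.DL_Rank"
begin

text \<open>The eigenvalues of the symmetric matrix $A^T A$ are real, so the real roots of its
  characteristic polynomial, taken with multiplicity, are all of them.\<close>

definition singular_values :: "real mat \<Rightarrow> real list" where
  "singular_values A =
     rev (sorted_list_of_multiset
       (image_mset sqrt (proots (char_poly (transpose_mat A * A)))))"

text \<open>The list is decreasing and indexed from 0.\<close>

definition inv_singular_sum :: "nat \<Rightarrow> real mat \<Rightarrow> real" where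
  "inv_singular_sum t A = (\<Sum>i<t. 1 / (singular_values A ! i))"

definition realizes ::
  "'x set \<Rightarrow> 'y set \<Rightarrow> ('x \<Rightarrow> 'y \<Rightarrow> real) \<Rightarrow> nat \<Rightarrow> real mat \<Rightarrow> bool" where
  "realizes X Y f k A \<longleftrightarrow>
     (\<exists>x y. (\<forall>i<k. x i \<in> X \<and> y i \<in> Y) \<and> (\<forall>i<k. \<forall>j<k. A $$ (i, j) = f (x i) (y j)))"

text \<open>Deterministic two-party protocol trees: at an inner node the named party sends one bit
  computed from its own input, and the leaf reached carries the common output.\<close>

datatype ('a, 'b, 'o) protocol =
    Output 'o
  | Alice "'a \<Rightarrow> bool" "('a, 'b, 'o) protocol" "('a, 'b, 'o) protocol"
  | Bob "'b \<Rightarrow> bool" "('a, 'b, 'o) protocol" "('a, 'b, 'o) protocol"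

primrec run :: "('a, 'b, 'o) protocol \<Rightarrow> 'a \<Rightarrow> 'b \<Rightarrow> 'o" where
  "run (Output z) a b = z"
| "run (Alice g P Q) a b = (if g a then run P a b else run Q a b)"
| "run (Bob g P Q) a b = (if g b then run P a b else run Q a b)"

primrec cost :: "('a, 'b, 'o) protocol \<Rightarrow> nat" where
  "cost (Output z) = 0"
| "cost (Alice g P Q) = Suc (max (cost P) (cost Q))"
| "cost (Bob g P Q) = Suc (max (cost P) (cost Q))"

definition mean :: "('x \<Rightarrow> 'y \<Rightarrow> real) \<Rightarrow> 'x pmf \<Rightarrow> 'y pmf \<Rightarrow> real" where
  "mean f p q = measure_pmf.expectation (pair_pmf p q) (\<lambda>(x, y). f x y)"

text \<open>A shared-randomness protocol is a probability measure on deterministic protocols. Any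
  probability space of shared random strings can be used: push it forward to the protocols, with
  the largest \<open>\<sigma>\<close>-algebra that keeps the map from strings to protocols measurable.\<close>

definition estimates ::
  "real \<Rightarrow> 'x set \<Rightarrow> 'y set \<Rightarrow> ('x \<Rightarrow> 'y \<Rightarrow> real) \<Rightarrow>
   ('x pmf, 'y pmf, real) protocol measure \<Rightarrow> bool" where
  "estimates \<epsilon> X Y f M \<longleftrightarrow>
     prob_space M \<and>
     (\<forall>p q. set_pmf p \<subseteq> X \<longrightarrow> set_pmf q \<subseteq> Y \<longrightarrow>
        {P \<in> space M. \<bar>run P p q - mean f p q\<bar> \<le> \<epsilon>} \<in> sets M \<and>
        measure M {P \<in> space M. \<bar>run P p q - mean f p q\<bar> \<le> \<epsilon>} \<ge> 2 / 3)"

text \<open>The infimum is attained whenever some protocol exists, and is \<open>\<infinity>\<close> otherwise.\<close>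

definition dist_est_complexity ::
  "real \<Rightarrow> 'x set \<Rightarrow> 'y set \<Rightarrow> ('x \<Rightarrow> 'y \<Rightarrow> real) \<Rightarrow> enat" where
  "dist_est_complexity \<epsilon> X Y f =
     Inf {enat d | d. \<exists>M. estimates \<epsilon> X Y f M \<and> (\<forall>P\<in>space M. cost P \<le> d)}"

text \<open>A constant function needs no communication, although it realizes the \<open>1 \<times> 1\<close> matrix with
  entry 1, for which \<open>min t (t\<^sup>2 / (\<epsilon>\<^sup>2 k\<^sup>2 \<lambda>\<^sub>t\<^sup>2))\<close> is 1 at \<open>t = 1\<close> and \<open>\<epsilon> \<le> 1\<close>. Hence a bound by a
  positive multiple of this minimum can only hold with the complexity counted as at least one
  bit, which is equivalent to asking for it only once the minimum exceeds an absolute constant.\<close>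

lemma dist_est_complexity_const:
  assumes "\<epsilon> \<ge> 0"
  shows "dist_est_complexity \<epsilon> X Y (\<lambda>_ _. a) = 0"
proof -
  let ?M = "return (count_space {Output a}) (Output a) :: ('a pmf, 'b pmf, real) protocol measure"
  have M: "prob_space ?M"
    by (rule prob_space_return) simp
  have sp: "space ?M = {Output a}"
    by simp
  have "estimates \<epsilon> X Y (\<lambda>_ _. a) ?M"
    unfolding estimates_def
  proof (intro conjI allI impI M)
    fix p :: "'a pmf" and q :: "'b pmf"
    have "(\<lambda>(x :: 'a, y :: 'b). a) = (\<lambda>_. a)"
      by auto
    then have "mean (\<lambda>_ _. a) p q = a"
      unfolding mean_def by (simp only: measure_pmf.prob_space lebesgue_integral_const) simp
    then have eq: "{P \<in> space ?M. \<bar>run P p q - mean (\<lambda>_ _. a) p q\<bar> \<le> \<epsilon>} = space ?M"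
      using assms by (auto simp: sp)
    show "{P \<in> space ?M. \<bar>run P p q - mean (\<lambda>_ _. a) p q\<bar> \<le> \<epsilon>} \<in> sets ?M"
      unfolding eq by (rule sets.top)
    show "measure ?M {P \<in> space ?M. \<bar>run P p q - mean (\<lambda>_ _. a) p q\<bar> \<le> \<epsilon>} \<ge> 2 / 3"
      unfolding eq using prob_space.prob_space[OF M] by simp
  qed
  moreover have "\<forall>P\<in>space ?M. cost P \<le> 0"
    by (simp add: sp)
  ultimately have "enat 0 \<in>
      {enat d | d. \<exists>M. estimates \<epsilon> X Y (\<lambda>_ _. a) M \<and> (\<forall>P\<in>space M. cost P \<le> d)}"
    by blast
  then have "dist_est_complexity \<epsilon> X Y (\<lambda>_ _. a) \<le> enat 0"
    unfolding dist_est_complexity_def by (rule Inf_lower)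
  then show ?thesis
    by (simp add: zero_enat_def[symmetric])
qed

end

theory Submission
  imports Defs "Jordan_Normal_Form.Spectral_Radius" "HOL-Combinatorics.List_Permutation"
begin

text \<open>Let $u_i, v_i$ be the singular vectors of $A$ and, for signs $x, y \in \{-1,1\}^t$, put
  $a_x = \sum_i x_i u_i / \sqrt{\sigma_i}$ and $b_y = \sum_i y_i v_i / \sqrt{\sigma_i}$. Then
  $a_x^T A b_y = \langle x, y\rangle$, and both vectors have $\ell_1$-norm at most
  $N = \sqrt{k \lambda_t}$. Splitting $b_y$ into positive and negative parts, and padding those of
  $a_x$ at one coordinate to total mass $N$, turns an estimation protocol into one that estimates
  $\langle x, y\rangle - s(x) g(y)$ up to $2 N^2 \varepsilon$; one independently chosen protocol for
  each of the four sign combinations succeeds on a $(2/3)^4$ fraction of the inputs.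

  If the communication is below a small multiple of $t$, some large rectangle $S \times T$ has a
  constant fraction of pairs with $\langle x,y\rangle = s(x) g(y) + Z(y) + O(E)$. By Pajor's lemma the
  useful $y$ in $T$ shatter a set $I$ of $\Omega(t)$ coordinates. In a large fibre of $S$ over the
  coordinates outside $I$ take three generic $x_1, x_2, x_3$ with
  $s(x_2) = \mu s(x_1) + (1-\mu) s(x_3)$: pairing with $v = x_2 - \mu x_1 - (1-\mu) x_3$ leaves only
  $\langle v, h\rangle$, which would be $O(E)$ for a constant fraction of all sign patterns $h$ on
  $I$. This contradicts binomial anti-concentration unless $E = \Omega(\sqrt t)$. The general case
  follows by passing to fewer singular values, as $\lambda_t / t$ is nondecreasing in $t$.\<close>

section \<open>Singular value decomposition\<close>

text \<open>The masses of the positive and negative parts are real numbers known to one party only,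
  while the output depends on the leaf alone. On a fixed leaf Bob's masses are harmless: they
  multiply constants and give some function of y, the Z(y) of the overview. Weights on both sides
  would instead leave a sum of several products of functions of x and y. Padding gives both of
  Alice's distributions the common mass N, at the price of a single product s(x) g(y). As s(x) is
  one real number, three inputs suffice to eliminate it, and a convex combination does so without
  amplifying the error.

  One draw of the protocol need not be correct on four queries at once: four failure probabilities
  of 1/3 exceed 1 in total. Choosing each protocol for the inputs on which the earlier ones succeed
  keeps a density of 16/81. The constants 8/81 and 4/81 are the density allowed on rectangles and
  the error accumulated over all leaves; together they stay below 16/81. The error scale E is 2 N^2
  \<epsilon> = 2 \<epsilon> k \<lambda>_t, which is how k \<lambda>_t enters the bound.\<close>

unbundle no inner_syntax

text \<open>Over the complex numbers an eigenvector \<open>w\<close> exists. Its Hermitian form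
  \<open>?q\<close> equals its own conjugate because \<open>B\<close> is real and symmetric, so the
  eigenvalue is real. It is then a root of the real characteristic polynomial and has a real
  eigenvector.\<close>

lemma symmetric_real_eigenvector:
  fixes B :: "real mat"
  assumes B: "B \<in> carrier_mat n n" and sym: "transpose_mat B = B" and n: "n > 0"
  obtains e v where "v \<in> carrier_vec n" "v \<bullet> v = 1" "B *\<^sub>v v = e \<cdot>\<^sub>v v"
proof -
  let ?C = "map_mat complex_of_real B"
  have C: "?C \<in> carrier_mat n n" using B by simp
  from spectrum_non_empty[OF C] n obtain z where "z \<in> spectrum ?C" by auto
  then have "eigenvalue ?C z" by (simp add: spectrum_def)
  then obtain w where w: "w \<in> carrier_vec n" "w \<noteq> 0\<^sub>v n" "?C *\<^sub>v w = z \<cdot>\<^sub>v w"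
    using C unfolding eigenvalue_def eigenvector_def by auto
  have Cw: "(\<Sum>j<n. complex_of_real (B $$ (i,j)) * w $ j) = z * w $ i" if "i < n" for i
  proof -
    have "(?C *\<^sub>v w) $ i = (\<Sum>j<n. complex_of_real (B $$ (i,j)) * w $ j)"
      using that B w(1) by (auto simp: scalar_prod_def lessThan_atLeast0 intro!: sum.cong)
    then show ?thesis using that w by simp
  qed
  have sB: "B $$ (i,j) = B $$ (j,i)" if "i < n" "j < n" for i j
    using that B arg_cong[OF sym, of "\<lambda>M. M $$ (j,i)"] by simp
  let ?q = "\<Sum>i<n. \<Sum>j<n. cnj (w $ i) * complex_of_real (B $$ (i,j)) * w $ j"
  let ?N = "\<Sum>i<n. cnj (w $ i) * w $ i"
  have q1: "?q = z * ?N"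
    unfolding sum_distrib_left using Cw
    by (intro sum.cong refl) (simp add: sum_distrib_left[symmetric] mult.assoc mult.left_commute)
  have "cnj ?q = (\<Sum>i<n. \<Sum>j<n. cnj (w $ j) * complex_of_real (B $$ (j,i)) * w $ i)"
    by (auto simp: sB intro!: sum.cong)
  also have "\<dots> = ?q" by (rule sum.swap)
  finally have q2: "cnj ?q = ?q" .
  have N: "?N = complex_of_real (\<Sum>i<n. (cmod (w $ i))\<^sup>2)"
    unfolding of_real_sum complex_norm_square by (intro sum.cong refl) (rule mult.commute)
  obtain i0 where i0: "i0 < n" "w $ i0 \<noteq> 0" using w(1,2) by (metis eq_vecI carrier_vecD index_zero_vec)
  have "(\<Sum>i<n. (cmod (w $ i))\<^sup>2) > 0"
    by (rule sum_pos2[of _ i0]) (use i0 in auto)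
  then have N0: "?N \<noteq> 0" unfolding N by (simp del: of_real_sum)
  have "cnj ?N = ?N" unfolding N by (simp del: of_real_sum)
  then have "cnj z * ?N = z * ?N" using q1 q2 by (metis complex_cnj_mult)
  with N0 have "cnj z = z" by (simp only: mult_cancel_right) simp
  then obtain e where e: "z = complex_of_real e"
    using Reals_cnj_iff Reals_cases by metis
  have "poly (char_poly ?C) z = 0" using \<open>eigenvalue ?C z\<close> eigenvalue_root_char_poly[OF C] by simp
  then have "complex_of_real (poly (char_poly B) e) = 0"
    unfolding of_real_hom.char_poly_hom[OF B] e by simp
  then have "eigenvalue B e" using eigenvalue_root_char_poly[OF B] by simp
  then obtain u where u: "u \<in> carrier_vec n" "u \<noteq> 0\<^sub>v n" "B *\<^sub>v u = e \<cdot>\<^sub>v u"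
    using B unfolding eigenvalue_def eigenvector_def by auto
  have up: "u \<bullet> u > 0"
  proof -
    obtain i0 where i0: "i0 < n" "u $ i0 \<noteq> 0" using u(1,2) by (metis eq_vecI carrier_vecD index_zero_vec)
    have "(\<Sum>i\<in>{0..<n}. u $ i * u $ i) > 0"
      by (rule sum_pos2[of _ i0]) (use i0 in \<open>auto simp: not_square_less_zero zero_less_mult_iff\<close>)
    then show ?thesis using u(1) by (simp add: scalar_prod_def)
  qed
  let ?v = "(1 / sqrt (u \<bullet> u)) \<cdot>\<^sub>v u"
  have "?v \<bullet> ?v = 1" using u(1) up by (simp add: field_simps)
  moreover have "B *\<^sub>v ?v = e \<cdot>\<^sub>v ?v"
    using u B by (simp add: mult_mat_vec smult_smult_assoc mult.commute)
  ultimately show ?thesis using that[of ?v e] u(1) by simp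
qed

text \<open>\<open>H\<close> is the reflection in the hyperplane orthogonal to the difference of
  \<open>v\<close> and the first unit vector. Being symmetric and its own inverse, it can conjugate
  a symmetric matrix without destroying symmetry.\<close>

lemma householder_reflection:
  fixes v :: "real vec"
  assumes v: "v \<in> carrier_vec (Suc n)" and vv: "v \<bullet> v = 1"
  obtains H where "H \<in> carrier_mat (Suc n) (Suc n)" "transpose_mat H = H"
    "H * H = 1\<^sub>m (Suc n)" "H *\<^sub>v unit_vec (Suc n) 0 = v"
proof -
  define w where "w i = v $ i - (if i = 0 then 1 else 0)" for i
  define W where "W = (\<Sum>i<Suc n. w i * w i)"
  define c where "c = 2 / W"
  define H where "H = mat (Suc n) (Suc n) (\<lambda>(i,j). (if i = j then 1 else 0) - c * w i * w j)"
  have H: "H \<in> carrier_mat (Suc n) (Suc n)" by (simp add: H_def)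
  have HT: "transpose_mat H = H" by (rule eq_matI) (auto simp: H_def)
  \<comment> \<open>If \<open>v\<close> is the first unit vector then \<open>W\<close> is 0,
    division by zero makes \<open>c\<close> 0, and \<open>H\<close> is the identity. The equation
    covers this case as well.\<close>
  have cW: "c * c * W = 2 * c" by (simp add: c_def)
  have HH: "H * H = 1\<^sub>m (Suc n)"
  proof (rule eq_matI)
    fix i j assume "i < dim_row (1\<^sub>m (Suc n) :: real mat)" "j < dim_col (1\<^sub>m (Suc n) :: real mat)"
    then have ij: "i < Suc n" "j < Suc n" by auto
    have "(H * H) $$ (i,j) = (\<Sum>l<Suc n. ((if i = l then 1 else 0) - c * w i * w l) *
        ((if l = j then 1 else 0) - c * w l * w j))"
      using ij by (simp add: H_def scalar_prod_def lessThan_atLeast0 del: sum.op_ivl_Suc sum.lessThan_Suc)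
    also have "\<dots> = (\<Sum>l<Suc n. (if i = l then (if l = j then 1 else 0) - c * w l * w j else 0)
        - (if l = j then c * w i * w l else 0) + c * c * w i * w j * (w l * w l))"
      by (intro sum.cong refl) (auto simp: algebra_simps)
    also have "\<dots> = (if i = j then 1 else 0) - c * w i * w j - c * w i * w j + c * c * w i * w j * W"
      using ij unfolding sum.distrib sum_subtractf W_def sum_distrib_left[symmetric]
      by (simp del: sum.lessThan_Suc)
    also have "\<dots> = (if i = j then 1 else 0) - 2 * c * w i * w j + (c * c * W) * w i * w j"
      by (simp add: algebra_simps)
    finally show "(H * H) $$ (i,j) = 1\<^sub>m (Suc n) $$ (i,j)"
      using ij by (simp add: cW)
  qed (auto simp: H_def)
  have v1: "(\<Sum>i<Suc n. v $ i * v $ i) = 1"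
    using vv v by (simp add: scalar_prod_def lessThan_atLeast0)
  have "W = (\<Sum>i<Suc n. v $ i * v $ i - (if i = 0 then 2 * v $ i - 1 else 0))"
    unfolding W_def w_def by (intro sum.cong refl) (auto simp: algebra_simps)
  also have "\<dots> = 2 - 2 * v $ 0"
    unfolding sum_subtractf v1 by (simp del: sum.lessThan_Suc)
  finally have W: "W = - 2 * w 0" by (simp add: w_def)
  have Hv: "H *\<^sub>v unit_vec (Suc n) 0 = v"
  proof (rule eq_vecI)
    fix i assume "i < dim_vec v"
    then have i: "i < Suc n" using v by simp
    have "(H *\<^sub>v unit_vec (Suc n) 0) $ i = H $$ (i, 0)"
      using i H by (simp add: row_def)
    also have "\<dots> = (if i = 0 then 1 else 0) - c * w 0 * w i"
      using i by (simp add: H_def)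
    also have "\<dots> = v $ i"
    proof (cases "W = 0")
      case True
      have "w i * w i \<le> W" unfolding W_def
        by (rule member_le_sum[of i]) (use i in auto)
      then have "w i = 0" using True
        by (metis antisym mult_eq_0_iff zero_le_square)
      then show ?thesis by (simp add: w_def)
    next
      case False
      then have "c * w 0 = -1" using W by (simp add: c_def field_simps)
      then show ?thesis by (simp add: w_def)
    qed
    finally show "(H *\<^sub>v unit_vec (Suc n) 0) $ i = v $ i" .
  qed (use v H in auto)
  show ?thesis by (rule that[OF H HT HH Hv])
qed

text \<open>Deflation: a reflection carries a unit eigenvector to the first axis. This clears the
  first column below the diagonal, symmetry clears the first row, and the induction hypothesis
  applies to the remaining block.\<close>

lemma symmetric_orthogonal_diagonalization:
  fixes B :: "real mat"
  assumes "B \<in> carrier_mat n n" "transpose_mat B = B"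
  shows "\<exists>P D. P \<in> carrier_mat n n \<and> D \<in> carrier_mat n n \<and> diagonal_mat D \<and>
     transpose_mat P * P = 1\<^sub>m n \<and> B = P * D * transpose_mat P"
  using assms
proof (induction n arbitrary: B)
  case 0
  then show ?case
    by (intro exI[of _ "1\<^sub>m 0"]) (auto simp: diagonal_mat_def intro!: eq_matI)
next
  case (Suc n)
  note B = Suc.prems(1) and sym = Suc.prems(2)
  obtain e v where v: "v \<in> carrier_vec (Suc n)" "v \<bullet> v = 1" "B *\<^sub>v v = e \<cdot>\<^sub>v v"
    using symmetric_real_eigenvector[OF B sym zero_less_Suc] .
  obtain H where H: "H \<in> carrier_mat (Suc n) (Suc n)" "transpose_mat H = H"
    "H * H = 1\<^sub>m (Suc n)" "H *\<^sub>v unit_vec (Suc n) 0 = v"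
    using householder_reflection[OF v(1,2)] .
  define C where "C = H * B * H"
  have C: "C \<in> carrier_mat (Suc n) (Suc n)" using H B by (simp add: C_def)
  have CT: "transpose_mat C = C"
  proof -
    have "transpose_mat C = transpose_mat H * (transpose_mat B * transpose_mat H)"
      unfolding C_def using H(1) B by (subst transpose_mult[of _ "Suc n" "Suc n" _ "Suc n"]) (auto simp: transpose_mult)
    then show ?thesis using H B sym
      by (simp add: C_def assoc_mult_mat[of _ "Suc n" "Suc n" _ "Suc n" _ "Suc n"])
  qed
  have sC: "C $$ (i,j) = C $$ (j,i)" if "i < Suc n" "j < Suc n" for i j
    using that C arg_cong[OF CT, of "\<lambda>M. M $$ (j,i)"] by simp
  have "C *\<^sub>v unit_vec (Suc n) 0 = H *\<^sub>v (B *\<^sub>v v)"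
    using H B v unfolding C_def by (simp add: assoc_mult_mat_vec[of _ "Suc n" "Suc n" _ "Suc n"])
  also have "\<dots> = e \<cdot>\<^sub>v (H *\<^sub>v (H *\<^sub>v unit_vec (Suc n) 0))"
    using H v by (simp add: mult_mat_vec)
  also have "\<dots> = e \<cdot>\<^sub>v unit_vec (Suc n) 0"
    using H(1,3) by (subst assoc_mult_mat_vec[of _ "Suc n" "Suc n" _ "Suc n", symmetric]) auto
  finally have C0: "C *\<^sub>v unit_vec (Suc n) 0 = e \<cdot>\<^sub>v unit_vec (Suc n) 0" .
  have C0': "C $$ (i,0) = (if i = 0 then e else 0)" if "i < Suc n" for i
    using arg_cong[OF C0, of "\<lambda>u. u $ i"] that C by (auto simp: row_def)
  define C3 where "C3 = mat n n (\<lambda>(i,j). C $$ (Suc i, Suc j))"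
  have C3: "C3 \<in> carrier_mat n n" by (simp add: C3_def)
  have C3T: "transpose_mat C3 = C3" by (rule eq_matI) (auto simp: C3_def sC)
  define E where "E = mat 1 1 (\<lambda>_. e)"
  have E: "E \<in> carrier_mat 1 1" by (simp add: E_def)
  have Cb: "C = four_block_mat E (0\<^sub>m 1 n) (0\<^sub>m n 1) C3"
  proof (rule eq_matI, goal_cases)
    case (1 i j)
    then have "i < Suc n" "j < Suc n" by (auto simp: E_def C3_def)
    then show ?case
      using C0'[of i] C0'[of j] sC[of i j]
      by (cases i; cases j) (auto simp: E_def C3_def index_mat_four_block)
  qed (use C in \<open>auto simp: E_def C3_def\<close>)
  obtain P3 D3 where IH: "P3 \<in> carrier_mat n n" "D3 \<in> carrier_mat n n" "diagonal_mat D3"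
     "transpose_mat P3 * P3 = 1\<^sub>m n" "C3 = P3 * D3 * transpose_mat P3"
    using Suc.IH[OF C3 C3T] by blast
  define Q where "Q = four_block_mat (1\<^sub>m 1) (0\<^sub>m 1 n) (0\<^sub>m n 1) P3"
  define D where "D = four_block_mat E (0\<^sub>m 1 n) (0\<^sub>m n 1) D3"
  have Q: "Q \<in> carrier_mat (Suc n) (Suc n)" and D: "D \<in> carrier_mat (Suc n) (Suc n)"
    using IH E by (auto simp: Q_def D_def)
  have QT: "transpose_mat Q = four_block_mat (1\<^sub>m 1) (0\<^sub>m 1 n) (0\<^sub>m n 1) (transpose_mat P3)"
    unfolding Q_def using IH by (subst transpose_four_block_mat[of _ 1 1 _ n _ n]) auto
  have PT3: "transpose_mat P3 \<in> carrier_mat n n" using IH by simp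
  have QD: "Q * D = four_block_mat E (0\<^sub>m 1 n) (0\<^sub>m n 1) (P3 * D3)"
    unfolding Q_def D_def
    using IH E by (subst mult_four_block_mat[of _ 1 1 _ n _ n _ _ 1 _ n]) auto
  have "Q * D * transpose_mat Q = four_block_mat E (0\<^sub>m 1 n) (0\<^sub>m n 1) (P3 * D3 * transpose_mat P3)"
    unfolding QD QT using IH PT3 E
    by (subst mult_four_block_mat[of _ 1 1 _ n _ n _ _ 1 _ n]) auto
  then have QDQ: "C = Q * D * transpose_mat Q" unfolding Cb IH(5)[symmetric] by simp
  have QQ: "transpose_mat Q * Q = 1\<^sub>m (Suc n)"
  proof -
    have "transpose_mat Q * Q = four_block_mat (1\<^sub>m 1) (0\<^sub>m 1 n) (0\<^sub>m n 1) (1\<^sub>m n)"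
      unfolding QT unfolding Q_def using IH PT3
      by (subst mult_four_block_mat[of _ 1 1 _ n _ n _ _ 1 _ n]) auto
    also have "\<dots> = 1\<^sub>m (Suc n)" by (rule eq_matI) (auto simp: index_mat_four_block)
    finally show ?thesis .
  qed
  have Dd: "diagonal_mat D"
    using IH(2,3) E unfolding diagonal_mat_def D_def by (auto simp: index_mat_four_block)
  note as = assoc_mult_mat[of _ "Suc n" "Suc n" _ "Suc n" _ "Suc n"]
  have QTc: "transpose_mat Q \<in> carrier_mat (Suc n) (Suc n)" using Q by simp
  have T: "transpose_mat (H * Q) = transpose_mat Q * H"
    using H Q by (simp add: transpose_mult[of _ "Suc n" "Suc n"])
  have "transpose_mat (H * Q) * (H * Q) = transpose_mat Q * (H * H) * Q"
    unfolding T using H(1) Q QTc by (simp add: as)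
  then have "transpose_mat (H * Q) * (H * Q) = 1\<^sub>m (Suc n)"
    using H(1,3) QTc QQ by simp
  moreover have "B = (H * Q) * D * transpose_mat (H * Q)"
  proof -
    have "(H * Q) * D * transpose_mat (H * Q) = H * C * H"
      unfolding T QDQ using H(1) Q QTc D by (simp add: as)
    also have "\<dots> = (H * H) * B * (H * H)" unfolding C_def using H(1) B by (simp add: as)
    also have "\<dots> = B" unfolding H(3) using B by simp
    finally show ?thesis by simp
  qed
  ultimately show ?case using H(1) Q D Dd
    by (intro exI[of _ "H * Q"] exI[of _ D]) auto
qed

section \<open>Singular values and rank\<close>

lemma rank_le_of_sum_of_products:
  fixes A :: "real mat"
  assumes "A \<in> carrier_mat n nc"
    and "\<And>l m. l < n \<Longrightarrow> m < nc \<Longrightarrow> A $$ (l,m) = (\<Sum>j<r. F j l * G j m)"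
  shows "vec_space.rank n A \<le> r"
  using assms
proof (induction r arbitrary: A)
  case 0
  then have "A = 0\<^sub>m n nc" by (intro eq_matI) auto
  then show ?case using vec_space.rank_0I[where ?'a = real] by simp
next
  case (Suc r)
  define A1 where "A1 = mat n nc (\<lambda>(l,m). \<Sum>j<r. F j l * G j m)"
  define A2 where "A2 = mat n nc (\<lambda>(l,m). F r l * G r m)"
  have "A = A1 + A2" using Suc.prems by (intro eq_matI) (auto simp: A1_def A2_def)
  moreover have "vec_space.rank n A1 \<le> r" by (rule Suc.IH) (auto simp: A1_def)
  moreover have "vec_space.rank n A2 \<le> 1"
    by (rule vec_space.rank_le_1_product_entries[where f="F r" and g="G r"]) (auto simp: A2_def)
  moreover have "vec_space.rank n (A1 + A2) \<le> vec_space.rank n A1 + vec_space.rank n A2"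
    by (rule vec_space.rank_subadditive[of _ _ nc]) (auto simp: A1_def A2_def)
  ultimately show ?case by simp
qed

lemma diag_mat_length: "length (diag_mat D) = dim_row D"
  by (simp add: diag_mat_def)

lemma proots_prod_linear: "proots (\<Prod>a\<leftarrow>xs. [:- a, 1:]) = mset (xs :: real list)"
proof (induction xs)
  case (Cons x xs)
  have "(\<Prod>a\<leftarrow>xs. [:- a, 1:]) \<noteq> 0" by (auto simp: prod_list_zero_iff)
  then have "proots ([:- x, 1:] * (\<Prod>a\<leftarrow>xs. [:- a, 1:])) = {#x#} + mset xs"
    by (subst proots_mult) (simp_all add: Cons.IH del: mult_pCons_left)
  then show ?case by (simp del: mult_pCons_left)
qed simp

text \<open>The vectors \<open>W i\<close> are the unnormalised left singular vectors A v_i, of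
  length \<sigma>_i, so vanishing singular values need no separate treatment. With \<open>P\<close>
  diagonalizing A^T A, the columns of A P are orthogonal and their squared norms are the
  eigenvalues.\<close>

lemma singular_value_decomposition:
  fixes A :: "real mat"
  assumes A: "A \<in> carrier_mat k k"
  defines "\<sigma> \<equiv> \<lambda>i. singular_values A ! i"
  obtains V W :: "nat \<Rightarrow> nat \<Rightarrow> real"
  where "\<And>i j. i < k \<Longrightarrow> j < k \<Longrightarrow> (\<Sum>m<k. V i m * V j m) = (if i = j then 1 else 0)"
    and "\<And>i j. i < k \<Longrightarrow> j < k \<Longrightarrow> (\<Sum>m<k. W i m * W j m) = (if i = j then (\<sigma> i)\<^sup>2 else 0)"
    and "\<And>i l. i < k \<Longrightarrow> l < k \<Longrightarrow> (\<Sum>m<k. A $$ (l,m) * V i m) = W i l"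
    and "\<And>l m. l < k \<Longrightarrow> m < k \<Longrightarrow> A $$ (l,m) = (\<Sum>i<k. W i l * V i m)"
    and "\<And>i j. i \<le> j \<Longrightarrow> j < k \<Longrightarrow> \<sigma> j \<le> \<sigma> i"
    and "\<And>i. i < k \<Longrightarrow> \<sigma> i \<ge> 0"
proof -
  define B where "B = transpose_mat A * A"
  have B: "B \<in> carrier_mat k k" using A by (simp add: B_def)
  have "transpose_mat B = B" using A by (simp add: B_def transpose_mult[of _ k k])
  from symmetric_orthogonal_diagonalization[OF B this]
  obtain P D where P: "P \<in> carrier_mat k k" and D: "D \<in> carrier_mat k k" "diagonal_mat D"
    and PP: "transpose_mat P * P = 1\<^sub>m k" and BP: "B = P * D * transpose_mat P" by blast
  have PT: "transpose_mat P \<in> carrier_mat k k" using P by simp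
  have PP': "P * transpose_mat P = 1\<^sub>m k" using mat_mult_left_right_inverse[OF PT P PP] .
  note as = assoc_mult_mat[of _ k k _ k _ k]
  define Q where "Q = A * P"
  have Q: "Q \<in> carrier_mat k k" using A P by (simp add: Q_def)
  have AT: "transpose_mat A \<in> carrier_mat k k" using A by simp
  have "transpose_mat Q * Q = transpose_mat P * B * P"
    using A P PT AT by (simp add: Q_def B_def transpose_mult[of _ k k] as)
  also have "\<dots> = (transpose_mat P * P) * D * (transpose_mat P * P)"
    unfolding BP using P PT D by (simp add: as)
  also have "\<dots> = D" unfolding PP using D by simp
  finally have QQ: "transpose_mat Q * Q = D" .
  have QPA: "Q * transpose_mat P = A" using A P PT PP' by (simp add: Q_def as)
  have "similar_mat B D" by (rule similar_matI[of _ _ P "transpose_mat P" k]) (use B D P PT PP PP' BP in auto)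
  then have "char_poly B = char_poly D" by (rule char_poly_similar)
  also have "\<dots> = (\<Prod>a\<leftarrow>diag_mat D. [:- a, 1:])"
    by (rule char_poly_upper_triangular[OF D(1)]) (use D in \<open>auto simp: diagonal_mat_def\<close>)
  finally have "proots (char_poly B) = mset (diag_mat D)"
    by (simp add: proots_prod_linear)
  then have "mset (singular_values A) = mset (map sqrt (diag_mat D))"
    by (simp add: singular_values_def B_def)
  moreover from this have len: "length (singular_values A) = k"
    using D(1) by (metis mset_eq_length length_map diag_mat_length carrier_matD(1))
  \<comment> \<open>The diagonal of \<open>D\<close> comes in no particular order, whereas
    \<open>singular_values\<close> is sorted; equality of the multisets provides the permutation
    between them.\<close>
  ultimately obtain \<pi> where \<pi>: "bij_betw \<pi> {..<k} {..<k}"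
      and \<sigma>\<pi>: "\<forall>i<k. \<sigma> i = map sqrt (diag_mat D) ! \<pi> i"
    using permutation_Ex_bij[of "singular_values A" "map sqrt (diag_mat D)"] D(1)
    unfolding \<sigma>_def by (auto simp: diag_mat_length)
  have \<pi>k: "\<pi> i < k" if "i < k" for i using \<pi> that by (auto simp: bij_betw_def)
  have \<pi>i: "\<pi> i = \<pi> j \<longleftrightarrow> i = j" if "i < k" "j < k" for i j
    using \<pi> that by (auto simp: bij_betw_def inj_on_def)
  have D_eq: "D $$ (i,j) = (\<Sum>l<k. Q $$ (l,i) * Q $$ (l,j))" if "i < k" "j < k" for i j
    unfolding QQ[symmetric] using that Q by (simp add: scalar_prod_def lessThan_atLeast0)
  have D0: "D $$ (i,i) \<ge> 0" if "i < k" for i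
    unfolding D_eq[OF that that] by (simp add: sum_nonneg)
  have \<sigma>2: "\<sigma> i = sqrt (D $$ (\<pi> i, \<pi> i))" if "i < k" for i
    using that \<sigma>\<pi> \<pi>k[OF that] D(1) by (simp add: diag_mat_def)
  show ?thesis
  proof (rule that[of "\<lambda>i m. P $$ (m, \<pi> i)" "\<lambda>i l. Q $$ (l, \<pi> i)"])
    fix i j assume ij: "i < k" "j < k"
    have "(transpose_mat P * P) $$ (\<pi> i, \<pi> j) = (\<Sum>m<k. P $$ (m, \<pi> i) * P $$ (m, \<pi> j))"
      using ij \<pi>k P by (simp add: scalar_prod_def lessThan_atLeast0)
    then show "(\<Sum>m<k. P $$ (m, \<pi> i) * P $$ (m, \<pi> j)) = (if i = j then 1 else 0)"
      unfolding PP using ij \<pi>k \<pi>i by simp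
    show "(\<Sum>m<k. Q $$ (m, \<pi> i) * Q $$ (m, \<pi> j)) = (if i = j then (\<sigma> i)\<^sup>2 else 0)"
      unfolding D_eq[OF \<pi>k[OF ij(1)] \<pi>k[OF ij(2)], symmetric]
      using ij D \<pi>k \<pi>i D0 \<sigma>2 by (auto simp: diagonal_mat_def)
  next
    fix i l assume "i < k" "l < k"
    then show "(\<Sum>m<k. A $$ (l, m) * P $$ (m, \<pi> i)) = Q $$ (l, \<pi> i)"
      using A P \<pi>k by (simp add: Q_def scalar_prod_def lessThan_atLeast0)
  next
    fix l m assume lm: "l < k" "m < k"
    have "A $$ (l,m) = (Q * transpose_mat P) $$ (l,m)" by (simp add: QPA)
    also have "\<dots> = (\<Sum>i<k. Q $$ (l, i) * P $$ (m, i))"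
      using lm Q P by (simp add: scalar_prod_def lessThan_atLeast0)
    also have "\<dots> = (\<Sum>i<k. Q $$ (l, \<pi> i) * P $$ (m, \<pi> i))"
      by (rule sum.reindex_bij_betw[OF \<pi>, symmetric])
    finally show "A $$ (l,m) = (\<Sum>i<k. Q $$ (l, \<pi> i) * P $$ (m, \<pi> i))" .
  next
    fix i j assume ij: "i \<le> j" "j < k"
    have "sorted_wrt (\<ge>) (singular_values A)"
      unfolding singular_values_def by (simp add: sorted_wrt_rev)
    then show "\<sigma> j \<le> \<sigma> i" unfolding \<sigma>_def using ij len sorted_wrt_nth_less[of "(\<ge>)" "singular_values A" i j]
      by (cases "i = j") auto
  next
    fix i assume "i < k"
    then show "\<sigma> i \<ge> 0" using \<sigma>2 D0 \<pi>k by simp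
  qed
qed

text \<open>Positivity is where the rank enters: a zero singular value at a position i below t
  forces all later ones, and their left vectors, to vanish. Then \<open>A\<close> is a sum of i
  products and has rank at most i.\<close>

lemma dual_bases_of_singular_values:
  fixes A :: "real mat"
  assumes A: "A \<in> carrier_mat k k" and t: "t \<le> vec_space.rank k A"
  defines "\<sigma> \<equiv> \<lambda>i. singular_values A ! i"
  obtains a b :: "nat \<Rightarrow> nat \<Rightarrow> real"
  where "\<And>i j. i < t \<Longrightarrow> j < t \<Longrightarrow> (\<Sum>l<k. \<Sum>m<k. a i l * A $$ (l,m) * b j m) = (if i = j then 1 else 0)"
    and "\<And>i j. i < t \<Longrightarrow> j < t \<Longrightarrow> (\<Sum>l<k. a i l * a j l) = (if i = j then 1 / \<sigma> i else 0)"
    and "\<And>i j. i < t \<Longrightarrow> j < t \<Longrightarrow> (\<Sum>l<k. b i l * b j l) = (if i = j then 1 / \<sigma> i else 0)"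
    and "\<And>i j. i \<le> j \<Longrightarrow> j < t \<Longrightarrow> \<sigma> j \<le> \<sigma> i"
    and "\<And>i. i < t \<Longrightarrow> \<sigma> i > 0"
proof -
  obtain V W :: "nat \<Rightarrow> nat \<Rightarrow> real"
    where V: "\<And>i j. i < k \<Longrightarrow> j < k \<Longrightarrow> (\<Sum>m<k. V i m * V j m) = (if i = j then 1 else 0)"
    and W: "\<And>i j. i < k \<Longrightarrow> j < k \<Longrightarrow> (\<Sum>m<k. W i m * W j m) = (if i = j then (\<sigma> i)\<^sup>2 else 0)"
    and AV: "\<And>i l. i < k \<Longrightarrow> l < k \<Longrightarrow> (\<Sum>m<k. A $$ (l,m) * V i m) = W i l"
    and AWV: "\<And>l m. l < k \<Longrightarrow> m < k \<Longrightarrow> A $$ (l,m) = (\<Sum>i<k. W i l * V i m)"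
    and mono: "\<And>i j. i \<le> j \<Longrightarrow> j < k \<Longrightarrow> \<sigma> j \<le> \<sigma> i"
    and nn: "\<And>i. i < k \<Longrightarrow> \<sigma> i \<ge> 0"
    using singular_value_decomposition[OF A, folded \<sigma>_def] by blast
  have tk: "t \<le> k" using t vec_space.rank_le_nc[OF A] by simp
  have pos: "\<sigma> i > 0" if i: "i < t" for i
  proof (rule ccontr)
    assume "\<not> \<sigma> i > 0"
    then have z: "\<sigma> j = 0" if "i \<le> j" "j < k" for j
      using mono[OF that] nn[OF that(2)] by linarith
    have W0: "W j l = 0" if "i \<le> j" "j < k" "l < k" for j l
    proof -
      have "(\<Sum>m<k. W j m * W j m) = 0" using W[of j j] z[of j] that by simp
      then show ?thesis using that(3) by (subst (asm) sum_nonneg_eq_0_iff) auto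
    qed
    have "vec_space.rank k A \<le> i"
    proof (rule rank_le_of_sum_of_products[OF A, where F=W and G=V])
      fix l m assume lm: "l < k" "m < k"
      show "A $$ (l,m) = (\<Sum>j<i. W j l * V j m)"
        unfolding AWV[OF lm] by (rule sum.mono_neutral_right) (use i tk W0 lm in auto)
    qed
    then show False using i t by simp
  qed
  \<comment> \<open>As \<open>W i\<close> has length \<sigma>_i, one factor \<sigma>_i normalises it
    and the factor sqrt \<sigma>_i is the scaling shared with \<open>b\<close>.\<close>
  define a where "a i l = W i l / (\<sigma> i * sqrt (\<sigma> i))" for i l
  define b where "b i l = V i l / sqrt (\<sigma> i)" for i l
  show ?thesis
  proof (rule that[of a b])
    fix i j assume ij: "i < t" "j < t"
    then have ijk: "i < k" "j < k" using tk by auto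
    have p: "\<sigma> i > 0" "\<sigma> j > 0" using pos ij by auto
    have "(\<Sum>l<k. \<Sum>m<k. a i l * A $$ (l,m) * b j m) = (\<Sum>l<k. a i l * (W j l / sqrt (\<sigma> j)))"
      unfolding b_def using ijk
      by (intro sum.cong refl) (simp add: AV[symmetric] sum_distrib_left sum_divide_distrib mult.assoc)
    also have "\<dots> = (\<Sum>l<k. W i l * W j l) / (\<sigma> i * sqrt (\<sigma> i) * sqrt (\<sigma> j))"
      by (simp add: a_def sum_divide_distrib)
    finally show "(\<Sum>l<k. \<Sum>m<k. a i l * A $$ (l,m) * b j m) = (if i = j then 1 else 0)"
      using ijk p by (simp add: W power2_eq_square)
    have "(\<Sum>l<k. a i l * a j l) = (\<Sum>l<k. W i l * W j l) / ((\<sigma> i * sqrt (\<sigma> i)) * (\<sigma> j * sqrt (\<sigma> j)))"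
      by (simp add: a_def sum_divide_distrib)
    then show "(\<Sum>l<k. a i l * a j l) = (if i = j then 1 / \<sigma> i else 0)"
      using ijk p by (simp add: W power2_eq_square)
    have "(\<Sum>l<k. b i l * b j l) = (\<Sum>l<k. V i l * V j l) / (sqrt (\<sigma> i) * sqrt (\<sigma> j))"
      by (simp add: b_def sum_divide_distrib)
    then show "(\<Sum>l<k. b i l * b j l) = (if i = j then 1 / \<sigma> i else 0)"
      using ijk p by (simp add: V)
  qed (use mono pos tk in auto)
qed

section \<open>Shattering and anti-concentration\<close>

definition shatters :: "'a set set \<Rightarrow> 'a set \<Rightarrow> bool" where
  "shatters F I \<longleftrightarrow> (\<forall>h\<subseteq>I. \<exists>y\<in>F. y \<inter> I = h)"

text \<open>Fix the new element i. \<open>F1\<close> consists of the traces of \<open>F\<close> on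
  \<open>U\<close> and \<open>F2\<close> of the traces attained both with and without i, so
  \<open>card F\<close> is \<open>card F1 + card F2\<close>. A set shattered by \<open>F1\<close> is
  shattered by \<open>F\<close> and avoids i; a set shattered by \<open>F2\<close> remains shattered
  by \<open>F\<close> after i is added. The two kinds of sets are disjoint.\<close>

lemma pajor:
  assumes "finite U" "F \<subseteq> Pow U"
  shows "card F \<le> card {I \<in> Pow U. shatters F I}"
  using assms
proof (induction U arbitrary: F rule: finite_induct)
  case empty
  have "F \<subseteq> {{}}" using empty by auto
  then consider "F = {}" | "F = {{}}" by blast
  then show ?case
  proof cases
    case 2
    then have "{I \<in> Pow {}. shatters F I} = {{}}" by (auto simp: shatters_def)
    then show ?thesis by (simp add: 2)
  qed simp
next
  case (insert i U)
  define F1 where "F1 = {y. y \<subseteq> U \<and> (y \<in> F \<or> insert i y \<in> F)}"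
  define F2 where "F2 = {y. y \<subseteq> U \<and> y \<in> F \<and> insert i y \<in> F}"
  have fin: "finite F" "finite (Pow (insert i U))"
    using insert.prems insert.hyps finite_subset[of F "Pow (insert i U)"] by auto
  have sub: "F1 \<subseteq> Pow U" "F2 \<subseteq> Pow U" by (auto simp: F1_def F2_def)
  have finU: "finite (Pow U)" using insert.hyps by simp
  define G0 where "G0 = {y \<in> F. i \<notin> y}"
  define G1 where "G1 = (\<lambda>y. y - {i}) ` {y \<in> F. i \<in> y}"
  have "card F = card (G0 \<union> {y \<in> F. i \<in> y})"
    by (rule arg_cong[of _ _ card]) (auto simp: G0_def)
  also have "\<dots> = card G0 + card {y \<in> F. i \<in> y}"
    by (rule card_Un_disjoint) (use fin(1) in \<open>auto simp: G0_def\<close>)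
  also have "card {y \<in> F. i \<in> y} = card G1"
    unfolding G1_def by (intro card_image[symmetric] inj_onI) (metis (mono_tags, lifting) insert_Diff mem_Collect_eq)
  also have "card G0 + card G1 = card (G0 \<union> G1) + card (G0 \<inter> G1)"
    by (rule card_Un_Int) (use fin in \<open>auto simp: G0_def G1_def\<close>)
  also have "G0 \<union> G1 = F1"
  proof
    have "y - {i} \<in> F1" if "y \<in> F" "i \<in> y" for y
    proof -
      have "insert i (y - {i}) \<in> F" using that insert_Diff by metis
      moreover have "y - {i} \<subseteq> U" using that insert.prems by blast
      ultimately show ?thesis using that unfolding F1_def by blast
    qed
    then have "G1 \<subseteq> F1" unfolding G1_def by (intro image_subsetI) simp
    moreover have "G0 \<subseteq> F1" using insert.prems by (auto simp: G0_def F1_def)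
    ultimately show "G0 \<union> G1 \<subseteq> F1" by simp
    show "F1 \<subseteq> G0 \<union> G1"
    proof
      fix y assume y: "y \<in> F1"
      then have ni: "i \<notin> y" using insert.hyps by (auto simp: F1_def)
      show "y \<in> G0 \<union> G1"
      proof (cases "y \<in> F")
        case True
        then show ?thesis using ni by (simp add: G0_def)
      next
        case False
        then have "insert i y \<in> {y \<in> F. i \<in> y}" using y by (simp add: F1_def)
        then have "insert i y - {i} \<in> G1" unfolding G1_def by (rule imageI)
        then show ?thesis using ni by simp
      qed
    qed
  qed
  also have "G0 \<inter> G1 = F2"
  proof
    have "y - {i} \<in> F2" if "y \<in> F" "i \<in> y" "y - {i} \<in> F" for y
    proof -
      have "insert i (y - {i}) \<in> F" using that insert_Diff by metis
      moreover have "y - {i} \<subseteq> U" using that insert.prems by blast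
      ultimately show ?thesis using that unfolding F2_def by blast
    qed
    then show "G0 \<inter> G1 \<subseteq> F2"
      unfolding G0_def G1_def by blast
    show "F2 \<subseteq> G0 \<inter> G1"
    proof
      fix y assume y: "y \<in> F2"
      then have ni: "i \<notin> y" using insert.hyps by (auto simp: F2_def)
      have "insert i y \<in> {y \<in> F. i \<in> y}" using y by (simp add: F2_def)
      then have "insert i y - {i} \<in> G1" unfolding G1_def by (rule imageI)
      then show "y \<in> G0 \<inter> G1" using ni y by (simp add: G0_def F2_def)
    qed
  qed
  finally have cF: "card F = card F1 + card F2" .
  let ?A = "{I \<in> Pow U. shatters F1 I}" and ?B = "{I \<in> Pow U. shatters F2 I}"
  have A: "shatters F I" if IU: "I \<subseteq> U" and sh: "shatters F1 I" for I
    unfolding shatters_def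
  proof (intro allI impI)
    fix h assume "h \<subseteq> I"
    then obtain y where y: "y \<in> F1" "y \<inter> I = h" using sh unfolding shatters_def by blast
    have "i \<notin> I" using IU insert.hyps by blast
    then have "insert i y \<inter> I = h" using y(2) by simp
    then show "\<exists>y\<in>F. y \<inter> I = h" using y unfolding F1_def by blast
  qed
  have B: "shatters F (insert i I)" if IU: "I \<subseteq> U" and sh: "shatters F2 I" for I
    unfolding shatters_def
  proof (intro allI impI)
    fix h assume h: "h \<subseteq> insert i I"
    then have "h - {i} \<subseteq> I" by auto
    then obtain y where y: "y \<in> F2" "y \<inter> I = h - {i}" using sh unfolding shatters_def by blast
    then have yU: "y \<subseteq> U" "y \<in> F" "insert i y \<in> F" by (auto simp: F2_def)
    show "\<exists>y\<in>F. y \<inter> insert i I = h"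
    proof (cases "i \<in> h")
      case True
      then have "insert i y \<inter> insert i I = h" using y(2) by blast
      then show ?thesis using yU by blast
    next
      case False
      moreover have "i \<notin> y" using yU(1) insert.hyps by blast
      ultimately have "y \<inter> insert i I = h" using y(2) by simp
      then show ?thesis using yU by blast
    qed
  qed
  have "card F \<le> card ?A + card ?B" unfolding cF
    by (intro add_mono insert.IH sub)
  also have "card ?B = card (insert i ` ?B)"
  proof (intro card_image[symmetric] inj_onI)
    fix I J assume "I \<in> ?B" "J \<in> ?B" "insert i I = insert i J"
    moreover have "i \<notin> I" "i \<notin> J" using calculation insert.hyps by auto
    ultimately show "I = J" by (simp add: insert_ident)
  qed
  also have "card ?A + card (insert i ` ?B) = card (?A \<union> insert i ` ?B)"
  proof (rule card_Un_disjoint[symmetric])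
    show "finite ?A" "finite (insert i ` ?B)" using finU by simp_all
    show "?A \<inter> insert i ` ?B = {}" using insert.hyps by blast
  qed
  also have "\<dots> \<le> card {I \<in> Pow (insert i U). shatters F I}"
  proof (rule card_mono)
    show "?A \<union> insert i ` ?B \<subseteq> {I \<in> Pow (insert i U). shatters F I}"
      using A B by blast
  qed (use fin in simp)
  finally show ?case .
qed

lemma sum_Pow_power_card:
  fixes \<theta> :: real
  assumes "finite U"
  shows "(\<Sum>I\<in>Pow U. \<theta> ^ card I) = (1 + \<theta>) ^ card U"
  using prod_add[OF assms, of "\<lambda>_. \<theta>" "\<lambda>_. 1::real"] by (simp add: prod_constant add.commute)

lemma sum_Pow_insert:
  fixes \<phi> :: "'a set \<Rightarrow> 'b::comm_monoid_add"
  assumes "finite U" "i \<notin> U"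
  shows "(\<Sum>a\<in>Pow (insert i U). \<phi> a) = (\<Sum>a\<in>Pow U. \<phi> a + \<phi> (insert i a))"
proof -
  have "(\<Sum>a\<in>Pow (insert i U). \<phi> a) = (\<Sum>a\<in>Pow U. \<phi> a) + (\<Sum>a\<in>insert i ` Pow U. \<phi> a)"
    unfolding Pow_insert by (rule sum.union_disjoint) (use assms in auto)
  also have "(\<Sum>a\<in>insert i ` Pow U. \<phi> a) = (\<Sum>a\<in>Pow U. \<phi> (insert i a))"
    by (rule sum.reindex_cong[of "insert i"]) (use assms in \<open>auto simp: inj_on_def\<close>)
  finally show ?thesis by (simp add: sum.distrib)
qed

text \<open>On these coordinates the sign vectors of \<open>a\<close> and \<open>c\<close> agree and
  are opposite to that of \<open>b\<close>. Subtracting any \<mu>, 1 - \<mu> combination of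
  \<open>a\<close> and \<open>c\<close> from \<open>b\<close> therefore leaves twice the sign of
  \<open>b\<close>, whatever \<mu> is. This is the part of the difference vector that stays under
  control.\<close>

definition odd_one_out :: "'a set \<Rightarrow> 'a set \<Rightarrow> 'a set \<Rightarrow> 'a set \<Rightarrow> 'a set" where
  "odd_one_out I a b c = {i \<in> I. (i \<in> a \<longleftrightarrow> i \<in> c) \<and> (i \<in> a \<longleftrightarrow> i \<notin> b)}"

text \<open>The weight factorises over coordinates. Of the eight membership patterns of a single
  coordinate exactly two make it odd, hence the factor 6 + 2 \<theta>.\<close>

lemma sum_power_card_odd_one_out:
  fixes \<theta> :: real
  assumes "finite I"
  shows "(\<Sum>a\<in>Pow I. \<Sum>b\<in>Pow I. \<Sum>c\<in>Pow I. \<theta> ^ card (odd_one_out I a b c)) = (6 + 2 * \<theta>) ^ card I"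
  using assms
proof (induction I rule: finite_induct)
  case empty
  then show ?case by (simp add: odd_one_out_def)
next
  case (insert i I)
  have eq: "\<theta> ^ card (odd_one_out (insert i I) a' b' c') =
      (if (i \<in> a' \<longleftrightarrow> i \<in> c') \<and> (i \<in> a' \<longleftrightarrow> i \<notin> b') then \<theta> else 1) * \<theta> ^ card (odd_one_out I a b c)"
    if "a' = a \<or> a' = insert i a" "b' = b \<or> b' = insert i b" "c' = c \<or> c' = insert i c" for a b c a' b' c'
  proof -
    have eq2: "odd_one_out I a' b' c' = odd_one_out I a b c"
      using that insert.hyps by (auto simp: odd_one_out_def)
    define z where "z \<longleftrightarrow> (i \<in> a' \<longleftrightarrow> i \<in> c') \<and> (i \<in> a' \<longleftrightarrow> i \<notin> b')"
    have "odd_one_out (insert i I) a' b' c' =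
        (if z then insert i (odd_one_out I a b c) else odd_one_out I a b c)"
      unfolding eq2[symmetric] by (auto simp: odd_one_out_def z_def)
    moreover have "finite (odd_one_out I a b c)" "i \<notin> odd_one_out I a b c"
      using insert.hyps by (auto simp: odd_one_out_def)
    ultimately show ?thesis unfolding z_def[symmetric] by simp
  qed
  have "(\<Sum>a\<in>Pow (insert i I). \<Sum>b\<in>Pow (insert i I). \<Sum>c\<in>Pow (insert i I).
        \<theta> ^ card (odd_one_out (insert i I) a b c)) =
      (\<Sum>a\<in>Pow I. \<Sum>b\<in>Pow I. \<Sum>c\<in>Pow I. (6 + 2 * \<theta>) * \<theta> ^ card (odd_one_out I a b c))"
    unfolding sum_Pow_insert[OF insert.hyps] sum.distrib[symmetric]
  proof (intro sum.cong refl)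
    fix a b c assume "a \<in> Pow I" "b \<in> Pow I" "c \<in> Pow I"
    then have ni: "i \<notin> a" "i \<notin> b" "i \<notin> c" using insert.hyps by auto
    show "\<theta> ^ card (odd_one_out (insert i I) a b c) +
          \<theta> ^ card (odd_one_out (insert i I) a b (insert i c)) +
          (\<theta> ^ card (odd_one_out (insert i I) a (insert i b) c) +
           \<theta> ^ card (odd_one_out (insert i I) a (insert i b) (insert i c))) +
          (\<theta> ^ card (odd_one_out (insert i I) (insert i a) b c) +
           \<theta> ^ card (odd_one_out (insert i I) (insert i a) b (insert i c)) +
           (\<theta> ^ card (odd_one_out (insert i I) (insert i a) (insert i b) c) +
            \<theta> ^ card (odd_one_out (insert i I) (insert i a) (insert i b) (insert i c)))) =
          (6 + 2 * \<theta>) * \<theta> ^ card (odd_one_out I a b c)"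
      using ni by (simp add: eq[where a=a and b=b and c=c] algebra_simps)
  qed
  also have "\<dots> = (6 + 2 * \<theta>) ^ card (insert i I)"
    using insert.hyps by (simp add: sum_distrib_left[symmetric] insert.IH)
  finally show ?case .
qed

text \<open>An exponential moment bound: each counted element has weight at least
  \<open>\<theta> ^ q\<close>. It serves to show that small sets and degenerate triples are rare,
  both times with \<theta> = 1/16.\<close>

lemma card_le_by_power_weight:
  fixes \<theta> :: real and \<nu> :: "'b \<Rightarrow> nat"
  assumes "finite X" "0 < \<theta>" "\<theta> \<le> 1" "(\<Sum>x\<in>X. \<theta> ^ \<nu> x) \<le> B"
  shows "real (card {x\<in>X. \<nu> x \<le> q}) * \<theta> ^ q \<le> B"
proof -
  have "real (card {x\<in>X. \<nu> x \<le> q}) * \<theta> ^ q = (\<Sum>x\<in>{x\<in>X. \<nu> x \<le> q}. \<theta> ^ q)" by simp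
  also have "\<dots> \<le> (\<Sum>x\<in>{x\<in>X. \<nu> x \<le> q}. \<theta> ^ \<nu> x)"
    by (intro sum_mono power_decreasing) (use assms in auto)
  also have "\<dots> \<le> (\<Sum>x\<in>X. \<theta> ^ \<nu> x)"
    by (intro sum_mono2) (use assms in auto)
  finally show ?thesis using assms by simp
qed

section \<open>Anti-concentration of sign sums\<close>

lemma central_binomial_upper_bound: "((2 * n) choose n)\<^sup>2 * (2 * n + 1) \<le> 16 ^ n"
proof (induction n)
  case (Suc n)
  let ?b = "(2 * n) choose n" and ?c = "(2 * Suc n) choose (Suc n)"
  have r: "Suc n * ?c = 2 * (2 * n + 1) * ?b"
  proof -
    have "Suc n * ?c = (2 * Suc n) * ((2 * n + 1) choose n)"
      using Suc_times_binomial[of n "2 * n + 1"] by (simp add: mult.commute)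
    moreover have "Suc n * ((2 * n + 1) choose n) = (2 * n + 1) * ?b"
    proof -
      have "((2 * n + 1) choose n) = ((2 * n + 1) choose Suc n)"
        using binomial_symmetric[of n "2 * n + 1"] by simp
      then show ?thesis using Suc_times_binomial[of n "2 * n"] by (simp add: mult.commute)
    qed
    ultimately have "Suc n * (Suc n * ?c) = Suc n * (2 * (2 * n + 1) * ?b)"
      by (simp add: algebra_simps)
    then show ?thesis by (subst (asm) nat_mult_eq_cancel1) simp_all
  qed
  have "(Suc n)\<^sup>2 * (?c\<^sup>2 * (2 * Suc n + 1)) = (Suc n * ?c)\<^sup>2 * (2 * n + 3)"
  proof -
    have "2 * Suc n + 1 = 2 * n + 3" by simp
    then show ?thesis unfolding power_mult_distrib by (simp only: mult.assoc)
  qed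
  also have "\<dots> = (?b\<^sup>2 * (2 * n + 1)) * (4 * ((2 * n + 1) * (2 * n + 3)))"
  proof -
    have "(2 * (2 * n + 1) * b)\<^sup>2 * (2 * n + 3) = (b\<^sup>2 * (2 * n + 1)) * (4 * ((2 * n + 1) * (2 * n + 3)))" for b
      by (simp add: power2_eq_square algebra_simps)
    then show ?thesis unfolding r .
  qed
  \<comment> \<open>Here (2n+1)(2n+3) is at most (2n+2)^2. The factor 2n+1 in the statement is what
    brings the ratio of successive terms down to 16.\<close>
  also have "\<dots> \<le> 16 ^ n * (4 * (4 * (Suc n)\<^sup>2))"
  proof (rule mult_le_mono[OF Suc.IH])
    show "4 * ((2 * n + 1) * (2 * n + 3)) \<le> 4 * (4 * (Suc n)\<^sup>2)"
      by (simp add: power2_eq_square algebra_simps)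
  qed
  finally have "(Suc n)\<^sup>2 * (?c\<^sup>2 * (2 * Suc n + 1)) \<le> (Suc n)\<^sup>2 * 16 ^ Suc n"
    by (simp add: mult.commute)
  then show ?case by (subst (asm) nat_mult_le_cancel1) auto
qed simp

text \<open>Even rows compare with the central coefficient. An entry of row 2m+1 is by Pascal's rule
  a sum of at most two entries of row 2m, and the central bound already carries the root of
  2m+1.\<close>

lemma binomial_mult_sqrt_le_two_power: "real (n choose j) * sqrt (real n) \<le> 2 ^ n"
proof -
  have ev: "real ((2 * m) choose j) * sqrt (real (2 * m + 1)) \<le> 4 ^ m" for m j
  proof -
    have "((2 * m) choose j)\<^sup>2 * (2 * m + 1) \<le> ((2*m) choose m)\<^sup>2 * (2 * m + 1)"
      using binomial_maximum'[of m j] by (intro mult_mono power_mono) auto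
    also note central_binomial_upper_bound[of m]
    finally have "real (((2 * m) choose j)\<^sup>2 * (2 * m + 1)) \<le> real (16 ^ m)"
      using of_nat_mono by blast
    moreover have "real (16 ^ m) = (4 ^ m)\<^sup>2" by (simp add: power2_eq_square flip: power_mult_distrib)
    ultimately have "(real ((2 * m) choose j) * sqrt (real (2 * m + 1)))\<^sup>2 \<le> (4 ^ m)\<^sup>2"
      unfolding power_mult_distrib by (simp add: algebra_simps)
    then show ?thesis by (rule power2_le_imp_le) simp
  qed
  show ?thesis
  proof (cases "even n")
    case True
    then obtain m where n: "n = 2 * m" by (auto elim: evenE)
    have "real (n choose j) * sqrt (real n) \<le> real ((2 * m) choose j) * sqrt (real (2 * m + 1))"
      unfolding n by (intro mult_mono) auto
    then show ?thesis using ev[of m j] by (simp add: n power_mult)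
  next
    case False
    then obtain m where n: "n = 2 * m + 1" by (auto elim: oddE)
    have "n choose j \<le> ((2 * m) choose (j - 1)) + ((2 * m) choose j)"
      by (cases j) (auto simp: n)
    then have "real (n choose j) * sqrt (real n) \<le>
        (real ((2 * m) choose (j - 1)) + real ((2 * m) choose j)) * sqrt (real (2 * m + 1))"
      unfolding n by (intro mult_right_mono) (simp_all flip: of_nat_add)
    also have "\<dots> \<le> 4 ^ m + 4 ^ m"
      using ev[of m j] ev[of m "j - 1"] by (simp only: distrib_right add_mono)
    also have "\<dots> = 2 ^ n" by (simp add: n power_mult)
    finally show ?thesis .
  qed
qed

text \<open>Vectors in $\{-1,1\}^U$ are represented by the set of their positive coordinates.\<close>

definition sgn_vec :: "'a set \<Rightarrow> 'a \<Rightarrow> real" where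
  "sgn_vec x i = (if i \<in> x then 1 else -1)"

lemma sum_sgn_vec_mult:
  assumes "finite K"
  shows "(\<Sum>i\<in>K. sgn_vec b i * sgn_vec h i) = 2 * real (card {i\<in>K. i \<in> h \<longleftrightarrow> i \<in> b}) - real (card K)"
proof -
  have "(\<Sum>i\<in>K. sgn_vec b i * sgn_vec h i) = (\<Sum>i\<in>K. 2 * (if i \<in> h \<longleftrightarrow> i \<in> b then 1 else 0) - 1)"
    by (intro sum.cong) (auto simp: sgn_vec_def)
  also have "\<dots> = 2 * (\<Sum>i\<in>K. if i \<in> h \<longleftrightarrow> i \<in> b then 1 else 0) - real (card K)"
    by (simp add: sum_subtractf sum_distrib_left)
  also have "(\<Sum>i\<in>K. if i \<in> h \<longleftrightarrow> i \<in> b then 1 else 0) = real (card {i\<in>K. i \<in> h \<longleftrightarrow> i \<in> b})"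
    using assms by (simp add: sum.If_cases Int_def)
  finally show ?thesis .
qed

text \<open>Any two members differ by at most r/2, because four times each lies within r of \<rho>.
  The spacing 4 is the step of twice a sign sum when the number of agreements grows by one.\<close>

lemma card_nat_in_interval:
  fixes r \<rho> :: real
  assumes "r \<ge> 0" "finite J"
  shows "real (card {j\<in>J. \<bar>4 * real j - \<rho>\<bar> \<le> r}) \<le> r / 2 + 1"
proof -
  let ?L = "{j\<in>J. \<bar>4 * real j - \<rho>\<bar> \<le> r}"
  show ?thesis
  proof (cases "?L = {}")
    case False
    define l where "l = Min ?L"
    have fin: "finite ?L" using assms by simp
    have l: "l \<in> ?L" "\<And>j. j \<in> ?L \<Longrightarrow> l \<le> j" using Min_in[OF fin False] Min_le[OF fin] by (auto simp: l_def)
    have "?L \<subseteq> {l..l + nat \<lfloor>r / 2\<rfloor>}"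
    proof
      fix j assume j: "j \<in> ?L"
      then have "real j - real l \<le> r / 2" using l(1) by auto
      then have "real (j - l) \<le> r / 2" using l(2)[OF j] by (simp add: of_nat_diff)
      then have "j - l \<le> nat \<lfloor>r / 2\<rfloor>" by (simp add: le_nat_floor)
      then show "j \<in> {l..l + nat \<lfloor>r / 2\<rfloor>}" using l(2)[OF j] by auto
    qed
    then have "card ?L \<le> nat \<lfloor>r / 2\<rfloor> + 1" using card_mono[of "{l..l + nat \<lfloor>r / 2\<rfloor>}" ?L] by simp
    then have "real (card ?L) \<le> real (nat \<lfloor>r / 2\<rfloor>) + 1" by simp
    also have "\<dots> \<le> r / 2 + 1" using assms of_nat_floor[of "r / 2"] by simp
    finally show ?thesis .
  next
    case True
    then show ?thesis unfolding True using assms by simp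
  qed
qed

text \<open>Passing from \<open>h\<close> to the set of coordinates where it agrees with
  \<open>b\<close> is an involution on the subsets of \<open>K\<close>, so agreement counts are
  distributed like cardinalities.\<close>

lemma card_Pow_agreements:
  assumes "finite K"
  shows "card {h\<in>Pow K. card {i\<in>K. i \<in> h \<longleftrightarrow> i \<in> b} = j} = card K choose j"
proof -
  let ?\<phi> = "\<lambda>h. {i\<in>K. i \<in> h \<longleftrightarrow> i \<in> b}"
  have "bij_betw ?\<phi> {h\<in>Pow K. card (?\<phi> h) = j} {h\<in>Pow K. card h = j}"
    by (rule bij_betw_byWitness[where f' = ?\<phi>]) (auto intro: arg_cong[of _ _ card] simp: set_eq_iff)
  then have "card {h\<in>Pow K. card (?\<phi> h) = j} = card {h\<in>Pow K. card h = j}" by (rule bij_betw_same_card)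
  also have "\<dots> = card K choose j" using n_subsets[OF assms, of j] by (simp add: Pow_def)
  finally show ?thesis .
qed

text \<open>The sum depends only on the number of agreements with \<open>b\<close>. At most r/2 + 1
  such numbers are admissible, and each accounts for at most a 1/sqrt |K| fraction of the
  patterns.\<close>

lemma card_small_sgn_sums:
  fixes r \<rho> :: real
  assumes K: "finite K" and r: "r \<ge> 0"
  shows "real (card {h\<in>Pow K. \<bar>2 * (\<Sum>i\<in>K. sgn_vec b i * sgn_vec h i) + \<rho>\<bar> \<le> r}) * sqrt (card K)
     \<le> (r / 2 + 1) * 2 ^ card K"
proof -
  let ?ag = "\<lambda>h. card {i\<in>K. i \<in> h \<longleftrightarrow> i \<in> b}"
  let ?\<rho>' = "2 * real (card K) - \<rho>"
  let ?J = "{j\<in>{..card K}. \<bar>4 * real j - ?\<rho>'\<bar> \<le> r}"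
  have "{h\<in>Pow K. \<bar>2 * (\<Sum>i\<in>K. sgn_vec b i * sgn_vec h i) + \<rho>\<bar> \<le> r}
      = {h\<in>Pow K. \<bar>4 * real (?ag h) - ?\<rho>'\<bar> \<le> r}"
    unfolding sum_sgn_vec_mult[OF K] right_diff_distrib by (simp add: algebra_simps)
  also have "\<dots> \<subseteq> (\<Union>j\<in>?J. {h\<in>Pow K. ?ag h = j})"
    using K by (auto intro!: card_mono)
  finally have "card {h\<in>Pow K. \<bar>2 * (\<Sum>i\<in>K. sgn_vec b i * sgn_vec h i) + \<rho>\<bar> \<le> r}
      \<le> card (\<Union>j\<in>?J. {h\<in>Pow K. ?ag h = j})"
    by (rule card_mono[rotated]) (use K in auto)
  also have "\<dots> \<le> (\<Sum>j\<in>?J. card {h\<in>Pow K. ?ag h = j})" by (rule card_UN_le) simp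
  also have "\<dots> = (\<Sum>j\<in>?J. card K choose j)" by (simp only: card_Pow_agreements[OF K])
  finally have "real (card {h\<in>Pow K. \<bar>2 * (\<Sum>i\<in>K. sgn_vec b i * sgn_vec h i) + \<rho>\<bar> \<le> r}) * sqrt (card K)
      \<le> (\<Sum>j\<in>?J. real (card K choose j)) * sqrt (card K)"
    by (intro mult_right_mono) (simp_all flip: of_nat_sum)
  also have "\<dots> \<le> (\<Sum>j\<in>?J. 2 ^ card K)"
    unfolding sum_distrib_right by (intro sum_mono binomial_mult_sqrt_le_two_power)
  also have "\<dots> = real (card ?J) * 2 ^ card K" by simp
  also have "\<dots> \<le> (r / 2 + 1) * 2 ^ card K"
    by (intro mult_right_mono card_nat_in_interval r) auto
  finally show ?thesis .
qed

text \<open>Fixing the coordinates outside \<open>K\<close> turns their contribution into a shift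
  \<rho>. The bound for sign sums is uniform in the shift, so the coefficients outside
  \<open>K\<close> may be arbitrary reals.\<close>

lemma card_small_linear_forms:
  fixes v :: "'a \<Rightarrow> real"
  assumes I: "finite I" and K: "K \<subseteq> I" and r: "r \<ge> 0"
    and v: "\<And>i. i \<in> K \<Longrightarrow> v i = 2 * sgn_vec b i"
  shows "real (card {h\<in>Pow I. \<bar>\<Sum>i\<in>I. v i * sgn_vec h i\<bar> \<le> r}) * sqrt (card K)
     \<le> (r / 2 + 1) * 2 ^ card I"
proof -
  have fK: "finite K" "finite (I - K)" using I K by (auto intro: finite_subset)
  let ?S = "{h\<in>Pow I. \<bar>\<Sum>i\<in>I. v i * sgn_vec h i\<bar> \<le> r}"
  let ?\<rho> = "\<lambda>g. \<Sum>i\<in>I - K. v i * sgn_vec g i"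
  let ?T = "\<lambda>g. {h\<in>Pow K. \<bar>2 * (\<Sum>i\<in>K. sgn_vec b i * sgn_vec h i) + ?\<rho> g\<bar> \<le> r}"
  have split: "(\<Sum>i\<in>I. v i * sgn_vec h i) =
      2 * (\<Sum>i\<in>K. sgn_vec b i * sgn_vec (h \<inter> K) i) + ?\<rho> (h - K)" for h
  proof -
    have "(\<Sum>i\<in>I. v i * sgn_vec h i) = ?\<rho> h + (\<Sum>i\<in>K. v i * sgn_vec h i)"
      by (rule sum.subset_diff[OF K I])
    moreover have "?\<rho> h = ?\<rho> (h - K)" by (intro sum.cong) (auto simp: sgn_vec_def)
    moreover have "(\<Sum>i\<in>K. v i * sgn_vec h i) = 2 * (\<Sum>i\<in>K. sgn_vec b i * sgn_vec (h \<inter> K) i)"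
      unfolding sum_distrib_left by (intro sum.cong) (auto simp: sgn_vec_def v)
    ultimately show ?thesis by simp
  qed
  have "?S \<subseteq> (\<Union>g\<in>Pow (I - K). (\<lambda>h. h \<union> g) ` ?T g)"
  proof
    fix h assume h: "h \<in> ?S"
    then have "h - K \<in> Pow (I - K)" "h \<inter> K \<in> ?T (h - K)" by (auto simp: split)
    moreover have "h = (h \<inter> K) \<union> (h - K)" by auto
    ultimately show "h \<in> (\<Union>g\<in>Pow (I - K). (\<lambda>h. h \<union> g) ` ?T g)" by blast
  qed
  then have "card ?S \<le> card (\<Union>g\<in>Pow (I - K). (\<lambda>h. h \<union> g) ` ?T g)"
    by (rule card_mono[rotated]) (use fK in auto)
  also have "\<dots> \<le> (\<Sum>g\<in>Pow (I - K). card ((\<lambda>h. h \<union> g) ` ?T g))"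
    by (rule card_UN_le) (use fK in simp)
  also have "\<dots> \<le> (\<Sum>g\<in>Pow (I - K). card (?T g))"
    by (intro sum_mono card_image_le) (use fK in simp)
  finally have "real (card ?S) * sqrt (card K) \<le> (\<Sum>g\<in>Pow (I - K). real (card (?T g))) * sqrt (card K)"
    by (intro mult_right_mono) (simp_all flip: of_nat_sum)
  also have "\<dots> \<le> (\<Sum>g\<in>Pow (I - K). (r / 2 + 1) * 2 ^ card K)"
    unfolding sum_distrib_right by (intro sum_mono card_small_sgn_sums fK r)
  also have "\<dots> = (r / 2 + 1) * (2 ^ card (I - K) * 2 ^ card K)"
    using fK by (simp add: card_Pow)
  also have "(2::real) ^ card (I - K) * 2 ^ card K = 2 ^ card I"
    using I K by (simp add: card_Diff_subset fK card_mono flip: power_add)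
  finally show ?thesis .
qed

section \<open>Three-point cancellation on a fibre\<close>

definition sgn_ip :: "'a set \<Rightarrow> 'a set \<Rightarrow> 'a set \<Rightarrow> real" where
  "sgn_ip U x y = (\<Sum>i\<in>U. sgn_vec x i * sgn_vec y i)"

text \<open>Moving the middle point onto the segment between the other two cancels the term
  \<open>s x * g y\<close>; the constant term and the coordinates outside \<open>I\<close> cancel as well.\<close>

lemma card_common_approximations_le:
  fixes s :: "'a set \<Rightarrow> real" and E :: real
  assumes U: "finite U" and I: "I \<subseteq> U" and E: "E \<ge> 0"
    and fib: "x1 - I = w" "x2 - I = w" "x3 - I = w"
    and Y: "\<And>h. h \<subseteq> I \<Longrightarrow> Y h \<inter> I = h"
    and s: "s x1 \<le> s x2" "s x2 \<le> s x3"
    and H: "\<And>h x. h \<in> H \<Longrightarrow> x \<in> {x1,x2,x3} \<Longrightarrow> \<bar>sgn_ip U x (Y h) - s x * g (Y h) - Z (Y h)\<bar> \<le> E"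
    and HI: "H \<subseteq> Pow I"
  shows "real (card H) * sqrt (card (odd_one_out I x1 x2 x3)) \<le> (E + 1) * 2 ^ card I"
proof -
  have fI: "finite I" using U I by (rule finite_subset[rotated])
  \<comment> \<open>The middle point has the middle value of \<open>s\<close>, so \<mu> can be taken
    in [0,1]. The three errors then add up to at most E + \<mu> E + (1 - \<mu>) E = 2 E,
    independently of the size of \<open>s\<close>. If the outer values coincide, any \<mu> works and
    0 is taken.\<close>
  obtain \<mu> where \<mu>: "0 \<le> \<mu>" "\<mu> \<le> 1" "s x2 = \<mu> * s x1 + (1 - \<mu>) * s x3"
  proof (cases "s x1 = s x3")
    case True
    then show ?thesis using s that[of 0] by auto
  next
    case False
    then have lt: "s x1 < s x3" using s by auto
    define \<mu> where "\<mu> = (s x3 - s x2) / (s x3 - s x1)"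
    have "\<mu> * (s x3 - s x1) = s x3 - s x2" using lt by (simp add: \<mu>_def)
    then have "s x2 = \<mu> * s x1 + (1 - \<mu>) * s x3" by (simp add: algebra_simps)
    then show ?thesis using s lt by (intro that[of \<mu>]) (auto simp: \<mu>_def)
  qed
  define v where "v i = sgn_vec x2 i - \<mu> * sgn_vec x1 i - (1 - \<mu>) * sgn_vec x3 i" for i
  have small: "\<bar>\<Sum>i\<in>I. v i * sgn_vec h i\<bar> \<le> 2 * E" if h: "h \<in> H" for h
  proof -
    define L where "L x = sgn_ip U x (Y h) - s x * g (Y h) - Z (Y h)" for x
    define out where "out = (\<Sum>i\<in>U - I. sgn_vec w i * sgn_vec (Y h) i)"
    have ip: "sgn_ip U x (Y h) = out + (\<Sum>i\<in>I. sgn_vec x i * sgn_vec h i)" if "x - I = w" for x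
    proof -
      have "sgn_ip U x (Y h) = (\<Sum>i\<in>U - I. sgn_vec x i * sgn_vec (Y h) i) + (\<Sum>i\<in>I. sgn_vec x i * sgn_vec (Y h) i)"
        unfolding sgn_ip_def by (rule sum.subset_diff[OF I U])
      also have "(\<Sum>i\<in>U - I. sgn_vec x i * sgn_vec (Y h) i) = out"
        unfolding out_def by (intro sum.cong) (use that in \<open>auto simp: sgn_vec_def\<close>)
      also have "(\<Sum>i\<in>I. sgn_vec x i * sgn_vec (Y h) i) = (\<Sum>i\<in>I. sgn_vec x i * sgn_vec h i)"
        by (intro sum.cong) (use Y[of h] h HI in \<open>auto simp: sgn_vec_def\<close>)
      finally show ?thesis .
    qed
    have "(\<Sum>i\<in>I. v i * sgn_vec h i) = (\<Sum>i\<in>I. sgn_vec x2 i * sgn_vec h i)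
        - \<mu> * (\<Sum>i\<in>I. sgn_vec x1 i * sgn_vec h i) - (1 - \<mu>) * (\<Sum>i\<in>I. sgn_vec x3 i * sgn_vec h i)"
      unfolding v_def sum_distrib_left sum_subtractf[symmetric]
      by (intro sum.cong refl) (simp add: algebra_simps)
    also have "\<dots> = L x2 - \<mu> * L x1 - (1 - \<mu>) * L x3"
      unfolding L_def ip[OF fib(1)] ip[OF fib(2)] ip[OF fib(3)] \<mu>(3) by (simp add: algebra_simps)
    finally have eq: "(\<Sum>i\<in>I. v i * sgn_vec h i) = L x2 - \<mu> * L x1 - (1 - \<mu>) * L x3" .
    have b: "\<bar>L x1\<bar> \<le> E" "\<bar>L x2\<bar> \<le> E" "\<bar>L x3\<bar> \<le> E" using H[OF h] by (auto simp: L_def)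
    have "\<bar>\<mu> * L x1\<bar> \<le> \<mu> * E" "\<bar>(1 - \<mu>) * L x3\<bar> \<le> (1 - \<mu>) * E"
      using \<mu> b by (auto simp: abs_mult intro!: mult_left_mono)
    then have "\<bar>L x2 - \<mu> * L x1 - (1 - \<mu>) * L x3\<bar> \<le> E + \<mu> * E + (1 - \<mu>) * E" using b(2) by linarith
    then show ?thesis unfolding eq by (simp add: algebra_simps)
  qed
  have "H \<subseteq> {h\<in>Pow I. \<bar>\<Sum>i\<in>I. v i * sgn_vec h i\<bar> \<le> 2 * E}" using small HI by auto
  then have "card H \<le> card {h\<in>Pow I. \<bar>\<Sum>i\<in>I. v i * sgn_vec h i\<bar> \<le> 2 * E}"
    by (rule card_mono[rotated]) (use fI in simp)
  then have "real (card H) * sqrt (card (odd_one_out I x1 x2 x3))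
      \<le> real (card {h\<in>Pow I. \<bar>\<Sum>i\<in>I. v i * sgn_vec h i\<bar> \<le> 2 * E}) * sqrt (card (odd_one_out I x1 x2 x3))"
    by (intro mult_right_mono) auto
  also have "\<dots> \<le> (2 * E / 2 + 1) * 2 ^ card I"
    by (rule card_small_linear_forms[OF fI, where b=x2])
      (use E in \<open>auto simp: odd_one_out_def v_def sgn_vec_def algebra_simps\<close>)
  finally show ?thesis by simp
qed

lemma sum_fiber_le_sum_Pow:
  fixes \<phi> :: "'a set \<Rightarrow> real"
  assumes "finite I" "\<And>x. x \<in> F \<Longrightarrow> x - I = w" "\<And>a. \<phi> a \<ge> 0"
  shows "(\<Sum>x\<in>F. \<phi> (x \<inter> I)) \<le> (\<Sum>a\<in>Pow I. \<phi> a)"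
proof -
  have inj: "inj_on (\<lambda>x. x \<inter> I) F"
    by (rule inj_onI) (use assms(2) in blast)
  have "(\<Sum>x\<in>F. \<phi> (x \<inter> I)) = (\<Sum>a\<in>(\<lambda>x. x \<inter> I) ` F. \<phi> a)"
    by (simp add: sum.reindex[OF inj])
  also have "\<dots> \<le> (\<Sum>a\<in>Pow I. \<phi> a)"
    by (rule sum_mono2) (use assms in auto)
  finally show ?thesis .
qed

text \<open>Within a fibre a set is determined by its trace on \<open>I\<close>, so the sum over
  triples is at most the generating function over all traces, which at 1/16 is (6 + 2/16)^m =
  (49/8)^m. For q = m div 16 the factor 16^q is at most (6/5)^m, and (6/5)(49/8) is below 8, the
  base of the number of all triples of traces.\<close>

lemma card_degenerate_triples_le:
  assumes I: "finite I" and F: "finite F" "\<And>x. x \<in> F \<Longrightarrow> x - I = w"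
  shows "real (card {(a,b,c) \<in> F \<times> F \<times> F. card (odd_one_out I a b c) \<le> q}) \<le> 16 ^ q * (49/8) ^ card I"
proof -
  let ?\<theta> = "1/16 :: real"
  define \<psi> where "\<psi> a b c = ?\<theta> ^ card (odd_one_out I a b c)" for a b c
  have eq: "odd_one_out I a b c = odd_one_out I (a \<inter> I) (b \<inter> I) (c \<inter> I)" for a b c
    by (auto simp: odd_one_out_def)
  have "(\<Sum>x\<in>F \<times> F \<times> F. ?\<theta> ^ (case x of (a,b,c) \<Rightarrow> card (odd_one_out I a b c)))
      = (\<Sum>a\<in>F. \<Sum>b\<in>F. \<Sum>c\<in>F. ?\<theta> ^ card (odd_one_out I a b c))"
    by (simp add: sum.cartesian_product case_prod_beta)
  also have "\<dots> = (\<Sum>a\<in>F. \<Sum>b\<in>F. \<Sum>c\<in>F. \<psi> (a \<inter> I) (b \<inter> I) (c \<inter> I))"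
    unfolding \<psi>_def by (intro sum.cong refl arg_cong[where f="\<lambda>x. ?\<theta> ^ card x"] eq)
  also have "\<dots> \<le> (\<Sum>a\<in>F. \<Sum>b\<in>F. \<Sum>c\<in>Pow I. \<psi> (a \<inter> I) (b \<inter> I) c)"
  proof (intro sum_mono)
    show "(\<Sum>c\<in>F. \<psi> (a \<inter> I) (b \<inter> I) (c \<inter> I)) \<le> (\<Sum>c\<in>Pow I. \<psi> (a \<inter> I) (b \<inter> I) c)" for a b
      using sum_fiber_le_sum_Pow[OF I F(2), where \<phi>="\<psi> (a \<inter> I) (b \<inter> I)"] by (simp add: \<psi>_def)
  qed
  also have "\<dots> \<le> (\<Sum>a\<in>F. \<Sum>b\<in>Pow I. \<Sum>c\<in>Pow I. \<psi> (a \<inter> I) b c)"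
  proof (intro sum_mono)
    show "(\<Sum>b\<in>F. \<Sum>c\<in>Pow I. \<psi> (a \<inter> I) (b \<inter> I) c) \<le> (\<Sum>b\<in>Pow I. \<Sum>c\<in>Pow I. \<psi> (a \<inter> I) b c)" for a
      using sum_fiber_le_sum_Pow[OF I F(2), where \<phi>="\<lambda>b. \<Sum>c\<in>Pow I. \<psi> (a \<inter> I) b c"] by (simp add: \<psi>_def sum_nonneg)
  qed
  also have "\<dots> \<le> (\<Sum>a\<in>Pow I. \<Sum>b\<in>Pow I. \<Sum>c\<in>Pow I. \<psi> a b c)"
    using sum_fiber_le_sum_Pow[OF I F(2), where \<phi>="\<lambda>a. \<Sum>b\<in>Pow I. \<Sum>c\<in>Pow I. \<psi> a b c"] by (simp add: \<psi>_def sum_nonneg)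
  also have "\<dots> = (49/8) ^ card I"
    unfolding \<psi>_def sum_power_card_odd_one_out[OF I] by simp
  finally have "real (card {x\<in>F \<times> F \<times> F. (case x of (a,b,c) \<Rightarrow> card (odd_one_out I a b c)) \<le> q}) * ?\<theta> ^ q \<le> (49/8) ^ card I"
    by (intro card_le_by_power_weight) (use F in auto)
  moreover have "{x\<in>F \<times> F \<times> F. (case x of (a,b,c) \<Rightarrow> card (odd_one_out I a b c)) \<le> q}
     = {(a,b,c) \<in> F \<times> F \<times> F. card (odd_one_out I a b c) \<le> q}" by auto
  ultimately show ?thesis by (simp add: power_divide field_simps)
qed

text \<open>The sets with at most q elements are too few to include everything that Pajor's lemma
  produces. Their number is bounded with weight 1/16, whence the base 1 + 1/16.\<close>

lemma large_family_shatters_large_set: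
  assumes U: "finite U" and T: "T \<subseteq> Pow U" and big: "16 ^ q * (17/16) ^ card U < real (card T)"
  obtains I where "I \<subseteq> U" "shatters T I" "q < card I"
proof -
  have "real (card {I\<in>Pow U. card I \<le> q}) * (1/16) ^ q \<le> (1 + 1/16) ^ card U"
    by (rule card_le_by_power_weight) (use U in \<open>auto simp: sum_Pow_power_card\<close>)
  then have "real (card {I\<in>Pow U. card I \<le> q}) \<le> 16 ^ q * (17/16) ^ card U"
    by (simp add: power_divide field_simps)
  then have "card {I\<in>Pow U. card I \<le> q} < card {I\<in>Pow U. shatters T I}"
    using big pajor[OF U T] by linarith
  then have "\<not> {I\<in>Pow U. shatters T I} \<subseteq> {I\<in>Pow U. card I \<le> q}"
    using card_mono[of "{I\<in>Pow U. card I \<le> q}" "{I\<in>Pow U. shatters T I}"] U by auto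
  then obtain I where "I \<subseteq> U" "shatters T I" "\<not> card I \<le> q" by blast
  then show ?thesis using that[of I] by simp
qed

text \<open>The cube lies above its tangent at \<open>a\<close>; the difference is (D - a)^2 (D +
  2a).\<close>

lemma cube_tangent:
  fixes a D :: real
  assumes "a \<ge> 0" "D \<ge> 0"
  shows "D ^ 3 \<ge> 3 * a\<^sup>2 * D - 2 * a ^ 3"
proof -
  have "0 \<le> (D - a)\<^sup>2 * (D + 2 * a)" using assms by simp
  then show ?thesis by (simp add: power2_eq_square power3_eq_cube algebra_simps)
qed

lemma sum_cube_eq_sum_triples:
  fixes \<phi> :: "'b \<Rightarrow> real"
  shows "(\<Sum>x\<in>F. \<phi> x) ^ 3 = (\<Sum>(a,b,c)\<in>F \<times> F \<times> F. \<phi> a * \<phi> b * \<phi> c)"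
proof -
  have "(\<Sum>x\<in>F. \<phi> x) ^ 3 = (\<Sum>a\<in>F. \<phi> a) * ((\<Sum>b\<in>F. \<phi> b) * (\<Sum>c\<in>F. \<phi> c))"
    by (simp add: power3_eq_cube)
  also have "\<dots> = (\<Sum>a\<in>F. \<Sum>b\<in>F. \<Sum>c\<in>F. \<phi> a * \<phi> b * \<phi> c)"
    unfolding sum_product[of \<phi> F \<phi> F] unfolding sum_distrib_right unfolding sum_distrib_left
    by (simp only: mult.assoc)
  also have "\<dots> = (\<Sum>(a,b,c)\<in>F \<times> F \<times> F. \<phi> a * \<phi> b * \<phi> c)"
    by (simp add: sum.cartesian_product)
  finally show ?thesis .
qed

text \<open>By the power mean inequality an average triple of members of \<open>F\<close> is simultaneously good for
  an \<open>\<alpha>\<^sup>3\<close> fraction of the patterns \<open>h\<close>, and degenerate triples are too rare to matter.\<close>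

lemma no_dense_approximation_on_fiber:
  fixes s :: "'a set \<Rightarrow> real" and E \<alpha> :: real
  assumes U: "finite U" and I: "I \<subseteq> U" and E: "E \<ge> 0" and \<alpha>: "\<alpha> > 0"
    and F: "finite F" "\<And>x. x \<in> F \<Longrightarrow> x - I = w"
    and Y: "\<And>h. h \<subseteq> I \<Longrightarrow> Y h \<inter> I = h"
    and good: "\<And>x h. x \<in> F \<Longrightarrow> h \<subseteq> I \<Longrightarrow> good x h \<Longrightarrow>
        \<bar>sgn_ip U x (Y h) - s x * g (Y h) - Z (Y h)\<bar> \<le> E"
    and dense: "(\<Sum>h\<in>Pow I. \<Sum>x\<in>F. of_bool (good x h)) \<ge> \<alpha> * 2 ^ card I * real (card F)"
    and big: "3 * (16 ^ (card I div 16) * (49/8) ^ card I) < \<alpha> ^ 3 / 2 * real (card F) ^ 3"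
  shows "\<alpha> ^ 3 * sqrt (card I) \<le> 8 * (E + 1)"
proof -
  have fI: "finite I" using U I by (rule finite_subset[rotated])
  let ?n = "real (card F)" and ?q = "card I div 16" and ?m = "card I"
  define cnt where "cnt a b c = (\<Sum>h\<in>Pow I. of_bool (good a h) * of_bool (good b h) * of_bool (good c h) :: real)" for a b c
  define deg where "deg a b c \<longleftrightarrow> card (odd_one_out I a b c) \<le> ?q" for a b c
  \<comment> \<open>Which member of a triple has the middle value of \<open>s\<close> is not known
    in advance, so a triple is discarded if it is degenerate with any of its three members in the
    middle. \<open>odd_one_out\<close> is symmetric in the outer two arguments, so this covers all
    six orders.\<close>
  define NG where "NG = {(a,b,c) \<in> F \<times> F \<times> F. deg a b c \<or> deg b a c \<or> deg a c b}"
  have cnt_nn: "cnt a b c \<ge> 0" for a b c unfolding cnt_def by (intro sum_nonneg) auto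
  have cnt_le: "cnt a b c \<le> 2 ^ ?m" for a b c
  proof -
    have "cnt a b c \<le> (\<Sum>h\<in>Pow I. 1)" unfolding cnt_def by (intro sum_mono) auto
    then show ?thesis using fI by (simp add: card_Pow)
  qed
  have cnt_card: "cnt a b c = real (card {h\<in>Pow I. good a h \<and> good b h \<and> good c h})" for a b c
    unfolding cnt_def using fI by (simp add: sum.If_cases Int_def flip: of_bool_conj)
  have finF3: "finite (F \<times> F \<times> F)" using F by simp
  have NGfin: "finite NG" unfolding NG_def by (rule finite_subset[OF _ finF3]) auto
  have NGcard: "real (card NG) \<le> 3 * (16 ^ ?q * (49/8) ^ ?m)"
  proof -
    let ?A = "{(a,b,c) \<in> F \<times> F \<times> F. deg a b c}"
    let ?B = "{(a,b,c) \<in> F \<times> F \<times> F. deg b a c}"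
    let ?C = "{(a,b,c) \<in> F \<times> F \<times> F. deg a c b}"
    have A: "real (card ?A) \<le> 16 ^ ?q * (49/8) ^ ?m"
      unfolding deg_def by (rule card_degenerate_triples_le[OF fI F])
    have fA: "finite ?A" by (rule finite_subset[OF _ finF3]) auto
    have "?B \<subseteq> (\<lambda>(a,b,c). (b,a,c)) ` ?A" by (auto simp: image_def)
    then have B: "card ?B \<le> card ?A" using surj_card_le[OF fA] by blast
    have "?C \<subseteq> (\<lambda>(a,b,c). (a,c,b)) ` ?A" by (auto simp: image_def)
    then have C: "card ?C \<le> card ?A" using surj_card_le[OF fA] by blast
    have "NG = ?A \<union> ?B \<union> ?C" by (auto simp: NG_def)
    then have "card NG \<le> card ?A + card ?B + card ?C"
      using card_Un_le[of "?A \<union> ?B" ?C] card_Un_le[of ?A ?B] by simp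
    then have "real (card NG) \<le> 3 * real (card ?A)" using B C by linarith
    then show ?thesis using A by linarith
  qed
  let ?D = "\<lambda>h. \<Sum>x\<in>F. of_bool (good x h) :: real"
  let ?a = "\<alpha> * ?n"
  \<comment> \<open>The tangent is taken at the guaranteed average \<open>?a\<close> of the counts
    \<open>?D h\<close>. Summing it over all patterns uses only the lower bound on the total
    count.\<close>
  have "?a ^ 3 * 2 ^ ?m \<le> 3 * ?a\<^sup>2 * (\<Sum>h\<in>Pow I. ?D h) - 2 * ?a ^ 3 * 2 ^ ?m"
  proof -
    have "3 * ?a\<^sup>2 * (?a * 2 ^ ?m) \<le> 3 * ?a\<^sup>2 * (\<Sum>h\<in>Pow I. ?D h)"
      using dense by (intro mult_left_mono) (auto simp: algebra_simps)
    then show ?thesis by (simp add: power2_eq_square power3_eq_cube algebra_simps)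
  qed
  also have "\<dots> = (\<Sum>h\<in>Pow I. 3 * ?a\<^sup>2 * ?D h - 2 * ?a ^ 3)"
    using fI by (simp add: sum_subtractf sum_distrib_left card_Pow)
  also have "\<dots> \<le> (\<Sum>h\<in>Pow I. ?D h ^ 3)"
    by (intro sum_mono cube_tangent sum_nonneg) (use \<alpha> in auto)
  also have "\<dots> = (\<Sum>(a,b,c)\<in>F \<times> F \<times> F. cnt a b c)"
    unfolding sum_cube_eq_sum_triples cnt_def
    by (subst sum.swap) (simp add: case_prod_beta)
  finally have lower: "\<alpha> ^ 3 * ?n ^ 3 * 2 ^ ?m \<le> (\<Sum>(a,b,c)\<in>F \<times> F \<times> F. cnt a b c)"
    by (simp add: power_mult_distrib)
  \<comment> \<open>Otherwise the remaining triples would contribute at most half of the lower bound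
    and the discarded ones, by \<open>big\<close>, strictly less than the other half.\<close>
  have "\<exists>a b c. (a,b,c) \<in> F \<times> F \<times> F - NG \<and> cnt a b c > \<alpha> ^ 3 / 2 * 2 ^ ?m"
  proof (rule ccontr)
    assume "\<nexists>a b c. (a,b,c) \<in> F \<times> F \<times> F - NG \<and> cnt a b c > \<alpha> ^ 3 / 2 * 2 ^ ?m"
    then have le: "cnt a b c \<le> \<alpha> ^ 3 / 2 * 2 ^ ?m" if "(a,b,c) \<in> F \<times> F \<times> F - NG" for a b c
      using that not_le by blast
    have sub: "NG \<subseteq> F \<times> F \<times> F" by (auto simp: NG_def)
    have "(\<Sum>(a,b,c)\<in>F \<times> F \<times> F. cnt a b c)
        = (\<Sum>(a,b,c)\<in>F \<times> F \<times> F - NG. cnt a b c) + (\<Sum>(a,b,c)\<in>NG. cnt a b c)"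
      by (rule sum.subset_diff[OF sub finF3])
    also have "(\<Sum>(a,b,c)\<in>NG. cnt a b c) \<le> (\<Sum>_\<in>NG. 2 ^ ?m)"
      by (intro sum_mono) (auto simp: cnt_le)
    also have "(\<Sum>(a,b,c)\<in>F \<times> F \<times> F - NG. cnt a b c) \<le> (\<Sum>_\<in>F \<times> F \<times> F - NG. \<alpha> ^ 3 / 2 * 2 ^ ?m)"
      by (intro sum_mono) (use le in auto)
    also have "(\<Sum>_\<in>F \<times> F \<times> F - NG. \<alpha> ^ 3 / 2 * 2 ^ ?m) \<le> (\<Sum>_\<in>F \<times> F \<times> F. \<alpha> ^ 3 / 2 * 2 ^ ?m)"
      by (rule sum_mono2) (use finF3 \<alpha> in auto)
    also have "\<dots> = \<alpha> ^ 3 / 2 * 2 ^ ?m * ?n ^ 3"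
      by (simp add: card_cartesian_product power3_eq_cube)
    also have "(\<Sum>_\<in>NG. (2::real) ^ ?m) = real (card NG) * 2 ^ ?m" by simp
    also have "\<dots> < \<alpha> ^ 3 / 2 * ?n ^ 3 * 2 ^ ?m"
      using NGcard big by (intro mult_strict_right_mono) auto
    finally show False using lower by (simp add: algebra_simps)
  qed
  then obtain a b c where abc: "a \<in> F" "b \<in> F" "c \<in> F" "(a,b,c) \<notin> NG" and cnt: "cnt a b c > \<alpha> ^ 3 / 2 * 2 ^ ?m"
    by auto
  have nd: "\<not> deg a b c" "\<not> deg b a c" "\<not> deg a c b" using abc by (auto simp: NG_def)
  have sym: "odd_one_out I x y z = odd_one_out I z y x" for x y z by (auto simp: odd_one_out_def)
  then have nd': "\<not> deg c b a" "\<not> deg c a b" "\<not> deg b c a" using nd sym[of c b a] sym[of c a b] sym[of b c a] by (simp_all add: deg_def)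
  have main: "\<alpha> ^ 3 * sqrt ?m \<le> 8 * (E + 1)"
    if xyz: "{x,y,z} = {a,b,c}" and ss: "s x \<le> s y" "s y \<le> s z" and ndx: "\<not> deg x y z" for x y z
  proof -
    let ?H = "{h\<in>Pow I. good a h \<and> good b h \<and> good c h}"
    have xF: "x \<in> F" "y \<in> F" "z \<in> F" proof -
      have "{x,y,z} \<subseteq> F" unfolding xyz using abc by simp
      then show "x \<in> F" "y \<in> F" "z \<in> F" by simp_all
    qed
    have "real (card ?H) * sqrt (card (odd_one_out I x y z)) \<le> (E + 1) * 2 ^ ?m"
    proof (rule card_common_approximations_le[OF U I E, where w=w and Y=Y and s=s and g=g and Z=Z])
      fix h x' assume h: "h \<in> ?H" and "x' \<in> {x,y,z}"
      then have "x' \<in> {a,b,c}" using xyz by simp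
      then show "\<bar>sgn_ip U x' (Y h) - s x' * g (Y h) - Z (Y h)\<bar> \<le> E"
        using h abc by (intro good) auto
    qed (use F xF Y ss in auto)
    moreover have "\<alpha> ^ 3 / 2 * 2 ^ ?m * (sqrt ?m / 4) \<le> real (card ?H) * sqrt (card (odd_one_out I x y z))"
    proof (intro mult_mono)
      show "\<alpha> ^ 3 / 2 * 2 ^ ?m \<le> real (card ?H)" using cnt cnt_card[of a b c] by simp
      have "?q < card (odd_one_out I x y z)" using ndx by (simp add: deg_def)
      then have "?m \<le> 16 * card (odd_one_out I x y z)" by linarith
      then have "sqrt ?m \<le> sqrt (16 * real (card (odd_one_out I x y z)))"
        by (intro real_sqrt_le_mono) linarith
      also have "\<dots> = 4 * sqrt (card (odd_one_out I x y z))"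
        by (simp add: real_sqrt_mult)
      finally show "sqrt ?m / 4 \<le> sqrt (card (odd_one_out I x y z))" by simp
    qed auto
    ultimately have "\<alpha> ^ 3 / 2 * 2 ^ ?m * (sqrt ?m / 4) \<le> (E + 1) * 2 ^ ?m" by linarith
    then have "(\<alpha> ^ 3 * sqrt ?m) * (2 ^ ?m / 8) \<le> (8 * (E + 1)) * (2 ^ ?m / 8)" by (simp add: mult_ac)
    then show ?thesis by (rule mult_right_le_imp_le) simp
  qed
  consider "s a \<le> s b" "s b \<le> s c" | "s a \<le> s c" "s c \<le> s b" | "s b \<le> s a" "s a \<le> s c"
    | "s b \<le> s c" "s c \<le> s a" | "s c \<le> s a" "s a \<le> s b" | "s c \<le> s b" "s b \<le> s a" by linarith
  then show ?thesis
  proof cases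
    case 1 then show ?thesis using main[of a b c] nd by simp
  next
    case 2 then show ?thesis using main[of a c b] nd by (simp add: insert_commute)
  next
    case 3 then show ?thesis using main[of b a c] nd by (simp add: insert_commute)
  next
    case 4 then show ?thesis using main[of b c a] nd' by (simp add: insert_commute)
  next
    case 5 then show ?thesis using main[of c a b] nd' by (simp add: insert_commute)
  next
    case 6 then show ?thesis using main[of c b a] nd' by (simp add: insert_commute)
  qed
qed

text \<open>Both sides have at most 2^t members, so the product bound forces each to have at least
  \<beta> 2^t. The size of \<open>T\<close> is spent on finding a shattered set, that of
  \<open>S\<close> on finding a large fibre; \<open>shatter\<close> and \<open>generic\<close> state
  that these sizes suffice.\<close>

lemma no_dense_approximation_on_large_rectangle:
  fixes s :: "'a set \<Rightarrow> real" and E \<gamma> \<beta> :: real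
  assumes U: "finite U" and S: "S \<subseteq> Pow U" and T: "T \<subseteq> Pow U"
    and \<gamma>: "\<gamma> > 0" and \<beta>: "\<beta> > 0" and E: "E \<ge> 0"
    and large: "real (card S) * real (card T) \<ge> \<beta> * 4 ^ card U"
    and dense: "(\<Sum>x\<in>S. \<Sum>y\<in>T. of_bool (good x y)) \<ge> \<gamma> * real (card S) * real (card T)"
    and good: "\<And>x y. x \<in> S \<Longrightarrow> y \<in> T \<Longrightarrow> good x y \<Longrightarrow> \<bar>sgn_ip U x y - s x * g y - Z y\<bar> \<le> E"
    and shatter: "16 ^ (card U div 16) * (17/16) ^ card U < \<gamma> / 2 * \<beta> * 2 ^ card U"
    and generic: "\<And>m. card U \<le> 16 * m \<Longrightarrow> m \<le> card U \<Longrightarrow>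
        3 * (16 ^ (m div 16) * (49/8) ^ m) < (\<gamma>/4) ^ 3 / 2 * (\<gamma>/4 * \<beta> * 2 ^ m) ^ 3"
  shows "(\<gamma>/4) ^ 3 * sqrt (card U) \<le> 32 * (E + 1)"
proof -
  let ?t = "card U"
  have fS: "finite S" and fT: "finite T" using S T U by (auto intro: finite_subset)
  have cle: "real (card R) \<le> 2 ^ ?t" if "R \<subseteq> Pow U" for R
  proof -
    have "card R \<le> card (Pow U)" using that U by (intro card_mono) auto
    then have "real (card R) \<le> real (2 ^ ?t)" using U by (simp add: card_Pow del: of_nat_power)
    then show ?thesis by simp
  qed
  have 4: "(4::real) ^ ?t = 2 ^ ?t * 2 ^ ?t" by (simp flip: power_mult_distrib)
  have ST: "\<beta> * 2 ^ ?t * 2 ^ ?t \<le> real (card S) * real (card T)"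
    using large by (simp only: 4 mult.assoc)
  have "\<beta> * 2 ^ ?t * 2 ^ ?t \<le> real (card S) * 2 ^ ?t"
    using ST mult_left_mono[OF cle[OF T], of "real (card S)"] by linarith
  then have Sbig: "\<beta> * 2 ^ ?t \<le> real (card S)" by (rule mult_right_le_imp_le) simp
  have "\<beta> * 2 ^ ?t * 2 ^ ?t \<le> real (card T) * 2 ^ ?t"
    using ST mult_right_mono[OF cle[OF S], of "real (card T)"] by (simp only: mult.commute) linarith
  then have Tbig: "\<beta> * 2 ^ ?t \<le> real (card T)" by (rule mult_right_le_imp_le) simp
  have "0 < \<beta> * 2 ^ ?t" using \<beta> by simp
  then have Spos: "0 < real (card S)" using Sbig by linarith
  define G where "G x y = (of_bool (good x y) :: real)" for x y
  have G01: "0 \<le> G x y" "G x y \<le> 1" for x y by (auto simp: G_def)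
  \<comment> \<open>Columns below density \<gamma>/2 account for at most half of the dense pairs, so
    a \<gamma>/2 fraction of \<open>T\<close> survives. The thinning precedes shattering because
    only one column per pattern is kept afterwards, and each of these has to be dense by
    itself.\<close>
  define T' where "T' = {y\<in>T. (\<Sum>x\<in>S. G x y) \<ge> \<gamma> / 2 * real (card S)}"
  have T': "T' \<subseteq> T" "T' \<subseteq> Pow U" "finite T'" using T fT by (auto simp: T'_def)
  have "\<gamma> * real (card S) * real (card T) \<le> (\<Sum>y\<in>T. \<Sum>x\<in>S. G x y)"
    using dense unfolding G_def by (subst (asm) sum.swap) simp
  also have "\<dots> \<le> (\<Sum>y\<in>T. (if y \<in> T' then real (card S) else 0) + \<gamma> / 2 * real (card S))"
  proof (rule sum_mono)
    fix y assume "y \<in> T"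
    moreover have "(\<Sum>x\<in>S. G x y) \<le> real (card S)"
      using sum_mono[of S "\<lambda>x. G x y" "\<lambda>_. 1"] G01 by simp
    moreover have "0 \<le> \<gamma> / 2 * real (card S)" using \<gamma> by simp
    ultimately show "(\<Sum>x\<in>S. G x y) \<le> (if y \<in> T' then real (card S) else 0) + \<gamma> / 2 * real (card S)"
      by (auto simp: T'_def)
  qed
  also have "\<dots> = real (card T') * real (card S) + real (card T) * (\<gamma> / 2 * real (card S))"
  proof -
    have "T \<inter> T' = T'" using T' by auto
    then show ?thesis using fT by (simp add: sum.distrib sum.If_cases)
  qed
  finally have "(\<gamma> / 2 * real (card T)) * real (card S) \<le> real (card T') * real (card S)"
    by (simp add: algebra_simps)
  then have "\<gamma> / 2 * real (card T) \<le> real (card T')" using Spos by simp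
  moreover have "\<gamma> / 2 * (\<beta> * 2 ^ ?t) \<le> \<gamma> / 2 * real (card T)"
    using Tbig \<gamma> by (intro mult_left_mono) auto
  ultimately have "16 ^ (?t div 16) * (17/16) ^ ?t < real (card T')"
    using shatter by (simp only: mult.assoc)
  from large_family_shatters_large_set[OF U T'(2) this]
  obtain I where I: "I \<subseteq> U" "shatters T' I" "?t div 16 < card I" .
  have fI: "finite I" using I U by (auto intro: finite_subset)
  let ?m = "card I"
  have m: "?t \<le> 16 * ?m" "?m \<le> ?t" using I U by (auto intro: card_mono)
  have "\<forall>h. \<exists>y. h \<subseteq> I \<longrightarrow> y \<in> T' \<and> y \<inter> I = h" using I(2) unfolding shatters_def by blast
  then obtain Y where Y: "\<And>h. h \<subseteq> I \<Longrightarrow> Y h \<in> T' \<and> Y h \<inter> I = h" by metis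
  let ?W = "Pow (U - I)"
  define Sw where "Sw w = {x\<in>S. x - I = w}" for w
  define Q where "Q w = (\<Sum>h\<in>Pow I. \<Sum>x\<in>Sw w. G x (Y h))" for w
  have fibers: "(\<Sum>w\<in>?W. \<Sum>x\<in>Sw w. \<phi> x) = (\<Sum>x\<in>S. \<phi> x)" for \<phi> :: "'a set \<Rightarrow> real"
    unfolding Sw_def by (rule sum.group) (use fS U S in auto)
  have cW: "card ?W * 2 ^ ?m = 2 ^ ?t"
    using U I m fI by (simp add: card_Pow card_Diff_subset flip: power_add)
  have cW': "real (card ?W) * 2 ^ ?m = 2 ^ ?t" using arg_cong[OF cW, of real] by simp
  have cWpos: "real (card ?W) > 0" using U by (simp add: card_Pow)
  \<comment> \<open>One inequality secures two properties of the fibre. Its first term is the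
    density \<gamma>/4; its second, against the trivial bound 2^m times the fibre size for
    \<open>Q w\<close>, makes the fibre at least \<gamma>/4 of the average size. Summed over all
    fibres the two terms use up exactly the available density \<gamma>/2.\<close>
  have "\<exists>w\<in>?W. Q w \<ge> \<gamma>/4 * 2 ^ ?m * real (card (Sw w)) + \<gamma>/4 * 2 ^ ?m * real (card S) / real (card ?W)"
  proof (rule ccontr)
    assume "\<not> ?thesis"
    then have "(\<Sum>w\<in>?W. Q w) < (\<Sum>w\<in>?W. \<gamma>/4 * 2 ^ ?m * real (card (Sw w)) + \<gamma>/4 * 2 ^ ?m * real (card S) / real (card ?W))"
      using U by (intro sum_strict_mono) (auto simp: not_le)
    also have "\<dots> = \<gamma>/4 * 2 ^ ?m * (\<Sum>w\<in>?W. real (card (Sw w))) + \<gamma>/4 * 2 ^ ?m * real (card S)"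
      using cWpos by (simp add: sum.distrib sum_distrib_left)
    also have "(\<Sum>w\<in>?W. real (card (Sw w))) = real (card S)" using fibers[of "\<lambda>_. 1"] by simp
    also have "(\<Sum>w\<in>?W. Q w) = (\<Sum>h\<in>Pow I. \<Sum>x\<in>S. G x (Y h))"
      unfolding Q_def by (subst sum.swap) (simp only: fibers)
    finally have "(\<Sum>h\<in>Pow I. \<Sum>x\<in>S. G x (Y h)) < \<gamma>/2 * real (card S) * 2 ^ ?m" by (simp add: algebra_simps)
    moreover have "(\<Sum>h\<in>Pow I. \<Sum>x\<in>S. G x (Y h)) \<ge> (\<Sum>h\<in>Pow I. \<gamma>/2 * real (card S))"
      by (rule sum_mono) (use Y in \<open>auto simp: T'_def\<close>)
    ultimately show False using fI by (simp add: card_Pow mult_ac)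
  qed
  then obtain w where w: "w \<in> ?W"
    and Qw: "Q w \<ge> \<gamma>/4 * 2 ^ ?m * real (card (Sw w)) + \<gamma>/4 * 2 ^ ?m * real (card S) / real (card ?W)" by blast
  let ?n = "real (card (Sw w))"
  have p1: "0 \<le> \<gamma>/4 * 2 ^ ?m * ?n" using \<gamma> by simp
  have p2: "0 \<le> \<gamma>/4 * 2 ^ ?m * real (card S) / real (card ?W)" using \<gamma> by simp
  have "Q w \<le> (\<Sum>h\<in>Pow I. \<Sum>x\<in>Sw w. 1)" unfolding Q_def by (intro sum_mono G01)
  also have "\<dots> = 2 ^ ?m * ?n" using fI by (simp add: card_Pow)
  finally have "\<gamma>/4 * real (card S) / real (card ?W) * 2 ^ ?m \<le> ?n * 2 ^ ?m"
    using Qw p1 by (simp add: mult_ac)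
  then have n1: "\<gamma>/4 * real (card S) / real (card ?W) \<le> ?n" by (rule mult_right_le_imp_le) simp
  have "\<gamma>/4 * \<beta> * 2 ^ ?m = \<gamma>/4 * (\<beta> * 2 ^ ?t) / real (card ?W)"
    unfolding cW'[symmetric] using cWpos by simp
  also have "\<dots> \<le> \<gamma>/4 * real (card S) / real (card ?W)"
    using Sbig \<gamma> by (intro divide_right_mono mult_left_mono) auto
  finally have n: "\<gamma>/4 * \<beta> * 2 ^ ?m \<le> ?n" using n1 by linarith
  have "(\<gamma>/4) ^ 3 * sqrt ?m \<le> 8 * (E + 1)"
  proof (rule no_dense_approximation_on_fiber[OF U I(1) E, where F="Sw w" and w=w and Y=Y and s=s and g=g and Z=Z
        and good="\<lambda>x h. good x (Y h)"])
    show "finite (Sw w)" using fS by (simp add: Sw_def)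
    show "\<gamma>/4 * 2 ^ ?m * ?n \<le> (\<Sum>h\<in>Pow I. \<Sum>x\<in>Sw w. of_bool (good x (Y h)))"
      using Qw p2 unfolding Q_def G_def by linarith
    have "(\<gamma>/4) ^ 3 / 2 * (\<gamma>/4 * \<beta> * 2 ^ ?m) ^ 3 \<le> (\<gamma>/4) ^ 3 / 2 * ?n ^ 3"
      using n \<gamma> \<beta> by (intro mult_left_mono power_mono) auto
    then show "3 * (16 ^ (?m div 16) * (49/8) ^ ?m) < (\<gamma>/4) ^ 3 / 2 * ?n ^ 3"
      using generic[OF m] by linarith
    show "\<bar>sgn_ip U x (Y h) - s x * g (Y h) - Z (Y h)\<bar> \<le> E" if "x \<in> Sw w" "h \<subseteq> I" "good x (Y h)" for x h
      using that Y[of h] T' by (intro good) (auto simp: Sw_def)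
  qed (use \<gamma> Y in \<open>auto simp: Sw_def\<close>)
  moreover have "(\<gamma>/4) ^ 3 * (sqrt ?t / 4) \<le> (\<gamma>/4) ^ 3 * sqrt ?m"
  proof (intro mult_left_mono)
    have "sqrt ?t \<le> sqrt (16 * real ?m)" using m(1) by (intro real_sqrt_le_mono) linarith
    then show "sqrt ?t / 4 \<le> sqrt ?m" by (simp add: real_sqrt_mult)
  qed (use \<gamma> in auto)
  ultimately show ?thesis by linarith
qed

section \<open>Protocols\<close>

text \<open>Every message splits the rectangle in two. The term with \<gamma> is additive under such
  splits, while \<open>K\<close> is paid once per leaf, at most 2^d times. As \<open>good\<close>
  may depend on the inputs as well as on the output, the lemma can be applied to several protocols
  in turn.\<close>

lemma run_dense_le_if_rectangles_dense_le:
  fixes P :: "('a, 'b, 'o) protocol" and \<gamma> K :: real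
  assumes fin: "finite A" "finite B" and K: "K \<ge> 0"
    and rect: "\<And>S T z. S \<subseteq> A \<Longrightarrow> T \<subseteq> B \<Longrightarrow>
      (\<Sum>x\<in>S. \<Sum>y\<in>T. of_bool (good z x y)) \<le> \<gamma> * real (card S) * real (card T) + K"
    and "S \<subseteq> A" "T \<subseteq> B" "cost P \<le> d"
  shows "(\<Sum>x\<in>S. \<Sum>y\<in>T. of_bool (good (run P (p x) (q y)) x y))
      \<le> \<gamma> * real (card S) * real (card T) + 2 ^ d * K"
  using assms(5-7)
proof (induction P arbitrary: S T d)
  case (Output z)
  have "1 * K \<le> 2 ^ d * K" using K by (intro mult_right_mono) auto
  then show ?case using rect[OF Output(1,2), of z] by simp
next
  case (Alice g P Q)
  obtain e where d: "d = Suc e" using Alice.prems(3) by (cases d) auto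
  let ?S1 = "{x\<in>S. g (p x)}" and ?S2 = "{x\<in>S. \<not> g (p x)}"
  have fS: "finite S" using Alice.prems(1) fin by (auto intro: finite_subset)
  have split: "(\<Sum>x\<in>S. \<phi> x) = (\<Sum>x\<in>?S1. \<phi> x) + (\<Sum>x\<in>?S2. \<phi> x)" for \<phi> :: "_ \<Rightarrow> real"
  proof -
    have "?S1 \<union> ?S2 = S" by blast
    moreover have "sum \<phi> (?S1 \<union> ?S2) = sum \<phi> ?S1 + sum \<phi> ?S2"
      by (rule sum.union_disjoint) (use fS in auto)
    ultimately show ?thesis by (simp only:)
  qed
  have c: "real (card S) = real (card ?S1) + real (card ?S2)" using split[of "\<lambda>_. 1"] by simp
  have "(\<Sum>x\<in>?S1. \<Sum>y\<in>T. of_bool (good (run P (p x) (q y)) x y)) \<le> \<gamma> * real (card ?S1) * real (card T) + 2 ^ e * K"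
    by (rule Alice.IH(1)) (use Alice.prems d in auto)
  moreover have "(\<Sum>x\<in>?S2. \<Sum>y\<in>T. of_bool (good (run Q (p x) (q y)) x y)) \<le> \<gamma> * real (card ?S2) * real (card T) + 2 ^ e * K"
    by (rule Alice.IH(2)) (use Alice.prems d in auto)
  ultimately show ?case unfolding split c d by (simp add: algebra_simps)
next
  case (Bob g P Q)
  obtain e where d: "d = Suc e" using Bob.prems(3) by (cases d) auto
  let ?T1 = "{y\<in>T. g (q y)}" and ?T2 = "{y\<in>T. \<not> g (q y)}"
  have fT: "finite T" using Bob.prems(2) fin by (auto intro: finite_subset)
  have split: "(\<Sum>x\<in>T. \<phi> x) = (\<Sum>x\<in>?T1. \<phi> x) + (\<Sum>x\<in>?T2. \<phi> x)" for \<phi> :: "_ \<Rightarrow> real"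
  proof -
    have "?T1 \<union> ?T2 = T" by blast
    moreover have "sum \<phi> (?T1 \<union> ?T2) = sum \<phi> ?T1 + sum \<phi> ?T2"
      by (rule sum.union_disjoint) (use fT in auto)
    ultimately show ?thesis by (simp only:)
  qed
  have c: "real (card T) = real (card ?T1) + real (card ?T2)" using split[of "\<lambda>_. 1"] by simp
  have "(\<Sum>x\<in>S. \<Sum>y\<in>?T1. of_bool (good (run P (p x) (q y)) x y)) \<le> \<gamma> * real (card S) * real (card ?T1) + 2 ^ e * K"
    by (rule Bob.IH(1)) (use Bob.prems d in auto)
  moreover have "(\<Sum>x\<in>S. \<Sum>y\<in>?T2. of_bool (good (run Q (p x) (q y)) x y)) \<le> \<gamma> * real (card S) * real (card ?T2) + 2 ^ e * K"
    by (rule Bob.IH(2)) (use Bob.prems d in auto)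
  ultimately show ?case unfolding split c d by (simp add: sum.distrib algebra_simps)
qed

text \<open>The expected number of indices handled correctly is at least 2/3 of \<open>D\<close>, so
  some protocol attains it. Leaving \<open>D\<close> arbitrary allows the next protocol to be chosen
  for the survivors of the previous ones.\<close>

lemma exists_protocol_ok_on_many:
  fixes M :: "'m measure" and D :: "'i set"
  assumes M: "prob_space M" and D: "finite D"
    and ok: "\<And>i. i \<in> D \<Longrightarrow> {P\<in>space M. ok P i} \<in> sets M"
      "\<And>i. i \<in> D \<Longrightarrow> measure M {P\<in>space M. ok P i} \<ge> 2/3"
  obtains P where "P \<in> space M" "real (card {i\<in>D. ok P i}) \<ge> 2/3 * real (card D)"
proof -
  interpret prob_space M by fact
  let ?f = "\<lambda>P. \<Sum>i\<in>D. indicator {P\<in>space M. ok P i} P :: real"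
  have int: "integrable M ?f"
    by (intro Bochner_Integration.integrable_sum integrable_real_indicator ok) (auto simp: less_top[symmetric])
  have "expectation ?f = (\<Sum>i\<in>D. measure M {P\<in>space M. ok P i})"
    by (subst Bochner_Integration.integral_sum)
      (auto intro!: integrable_real_indicator ok sum.cong simp: less_top[symmetric] Int_absorb2 subset_eq)
  also have "\<dots> \<ge> (\<Sum>i\<in>D. 2/3)" by (intro sum_mono ok)
  finally have exp: "expectation ?f \<ge> 2/3 * real (card D)" by simp
  have "\<exists>P\<in>space M. ?f P \<ge> 2/3 * real (card D)"
  proof (rule ccontr)
    assume "\<not> ?thesis"
    then have "expectation ?f < 2/3 * real (card D)"
      by (intro expectation_less int AE_I2) (auto simp: not_le)
    then show False using exp by simp
  qed
  then obtain P where P: "P \<in> space M" "?f P \<ge> 2/3 * real (card D)" by blast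
  have "?f P = real (card {i\<in>D. ok P i})"
    using P(1) D by (simp add: indicator_def sum.If_cases Int_def)
  then show ?thesis using that P by simp
qed

text \<open>The indices 1 and 2 stand for the positive and negative parts of the two vectors,
  \<open>N\<close> is Alice's padded mass, and \<beta>1, \<beta>2 are Bob's masses.
  \<open>ident\<close> says that the signed combination of the four means recovers the inner product
  up to one product term.\<close>

lemma communication_bound:
  fixes M :: "('a, 'b, real) protocol measure" and \<Phi> :: "'a \<Rightarrow> 'b \<Rightarrow> real" and \<epsilon> N :: real
    and p1 p2 :: "'i set \<Rightarrow> 'a" and q1 q2 :: "'i set \<Rightarrow> 'b" and \<beta>1 \<beta>2 s g :: "'i set \<Rightarrow> real"
  defines "\<gamma> \<equiv> 8/81 :: real"
  assumes M: "prob_space M" and U: "finite U" and N: "N \<ge> 0" and \<epsilon>: "\<epsilon> \<ge> 0"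
    and est: "\<And>x y a b. x \<subseteq> U \<Longrightarrow> y \<subseteq> U \<Longrightarrow> a \<in> {p1 x, p2 x} \<Longrightarrow> b \<in> {q1 y, q2 y} \<Longrightarrow>
        {P\<in>space M. \<bar>run P a b - \<Phi> a b\<bar> \<le> \<epsilon>} \<in> sets M \<and>
        measure M {P\<in>space M. \<bar>run P a b - \<Phi> a b\<bar> \<le> \<epsilon>} \<ge> 2/3"
    and cost: "\<And>P. P \<in> space M \<Longrightarrow> cost P \<le> d"
    and \<beta>: "\<And>y. y \<subseteq> U \<Longrightarrow> \<beta>1 y \<ge> 0" "\<And>y. y \<subseteq> U \<Longrightarrow> \<beta>2 y \<ge> 0" "\<And>y. y \<subseteq> U \<Longrightarrow> \<beta>1 y + \<beta>2 y \<le> N"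
    and ident: "\<And>x y. x \<subseteq> U \<Longrightarrow> y \<subseteq> U \<Longrightarrow>
        N * (\<beta>1 y * (\<Phi> (p1 x) (q1 y) - \<Phi> (p2 x) (q1 y)) - \<beta>2 y * (\<Phi> (p1 x) (q2 y) - \<Phi> (p2 x) (q2 y)))
          = sgn_ip U x y - s x * g y"
    and shatter: "16 ^ (card U div 16) * (17/16) ^ card U < \<gamma> / 2 * (4/81 / 16 ^ d) * 2 ^ card U"
    and generic: "\<And>m. card U \<le> 16 * m \<Longrightarrow> m \<le> card U \<Longrightarrow>
        3 * (16 ^ (m div 16) * (49/8) ^ m) < (\<gamma>/4) ^ 3 / 2 * (\<gamma>/4 * (4/81 / 16 ^ d) * 2 ^ m) ^ 3"
  shows "(\<gamma>/4) ^ 3 * sqrt (card U) \<le> 32 * (2 * N\<^sup>2 * \<epsilon> + 1)"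
proof (rule ccontr)
  assume contra: "\<not> ?thesis"
  let ?\<beta> = "4/81 / 16 ^ d :: real"
  let ?t = "card U" and ?A = "Pow U"
  have fA: "finite ?A" using U by simp
  define ok where "ok a b z \<longleftrightarrow> \<bar>z - \<Phi> a b\<bar> \<le> \<epsilon>" for a b z
  define good where "good z1 z2 z3 z4 x y \<longleftrightarrow> ok (p1 x) (q1 y) z1 \<and> ok (p2 x) (q1 y) z2 \<and>
      ok (p1 x) (q2 y) z3 \<and> ok (p2 x) (q2 y) z4" for z1 z2 z3 z4 x y
  have step: "\<exists>P\<in>space M. real (card {(x,y)\<in>D. ok (p x) (q y) (run P (p x) (q y))}) \<ge> 2/3 * real (card D)"
    if D: "D \<subseteq> ?A \<times> ?A" and p: "p \<in> {p1,p2}" and q: "q \<in> {q1,q2}" for D p q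
  proof -
    have fD: "finite D" using D fA by (auto intro: finite_subset)
    obtain P where "P \<in> space M"
      "real (card {i\<in>D. ok (p (fst i)) (q (snd i)) (run P (p (fst i)) (q (snd i)))}) \<ge> 2/3 * real (card D)"
    proof (rule exists_protocol_ok_on_many[OF M fD, where ok="\<lambda>P i. ok (p (fst i)) (q (snd i)) (run P (p (fst i)) (q (snd i)))"])
      fix i assume "i \<in> D"
      then have i: "fst i \<subseteq> U" "snd i \<subseteq> U" using D by (auto simp: subset_eq mem_Times_iff)
      have "p (fst i) \<in> {p1 (fst i), p2 (fst i)}" "q (snd i) \<in> {q1 (snd i), q2 (snd i)}" using p q by auto
      from est[OF i this]
      show "{P\<in>space M. ok (p (fst i)) (q (snd i)) (run P (p (fst i)) (q (snd i)))} \<in> sets M"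
        "measure M {P\<in>space M. ok (p (fst i)) (q (snd i)) (run P (p (fst i)) (q (snd i)))} \<ge> 2/3"
        unfolding ok_def by blast+
    qed
    moreover have "{i\<in>D. ok (p (fst i)) (q (snd i)) (run P (p (fst i)) (q (snd i)))}
        = {(x,y)\<in>D. ok (p x) (q y) (run P (p x) (q y))}" for P by auto
    ultimately show ?thesis by auto
  qed
  define D where "D = ?A \<times> ?A"
  obtain P1 where P1: "P1 \<in> space M"
    "real (card {(x,y)\<in>D. ok (p1 x) (q1 y) (run P1 (p1 x) (q1 y))}) \<ge> 2/3 * real (card D)" (is "real (card ?D1) \<ge> _")
    using step[of D p1 q1] unfolding D_def by blast
  have D1: "?D1 \<subseteq> ?A \<times> ?A" by (auto simp: D_def)
  obtain P2 where P2: "P2 \<in> space M"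
    "real (card {(x,y)\<in>?D1. ok (p2 x) (q1 y) (run P2 (p2 x) (q1 y))}) \<ge> 2/3 * real (card ?D1)" (is "real (card ?D2) \<ge> _")
    using step[OF D1, of p2 q1] by blast
  have D2: "?D2 \<subseteq> ?A \<times> ?A" by (auto simp: D_def)
  obtain P3 where P3: "P3 \<in> space M"
    "real (card {(x,y)\<in>?D2. ok (p1 x) (q2 y) (run P3 (p1 x) (q2 y))}) \<ge> 2/3 * real (card ?D2)" (is "real (card ?D3) \<ge> _")
    using step[OF D2, of p1 q2] by blast
  have D3: "?D3 \<subseteq> ?A \<times> ?A" by (auto simp: D_def)
  obtain P4 where P4: "P4 \<in> space M"
    "real (card {(x,y)\<in>?D3. ok (p2 x) (q2 y) (run P4 (p2 x) (q2 y))}) \<ge> 2/3 * real (card ?D3)" (is "real (card ?D4) \<ge> _")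
    using step[OF D3, of p2 q2] by blast
  \<comment> \<open>Four successive choices each keep 2/3 of the pairs, and (2/3)^4 = 16/81.\<close>
  have "real (card ?D4) \<ge> 16/81 * real (card D)" using P1 P2 P3 P4 by linarith
  moreover have cD: "real (card D) = 4 ^ ?t"
    using U by (simp add: D_def card_cartesian_product card_Pow flip: power_mult_distrib)
  moreover have "real (card ?D4) = (\<Sum>x\<in>?A. \<Sum>y\<in>?A. of_bool (good (run P1 (p1 x) (q1 y)) (run P2 (p2 x) (q1 y))
      (run P3 (p1 x) (q2 y)) (run P4 (p2 x) (q2 y)) x y))"
  proof -
    have "?D4 = D \<inter> {(x,y). good (run P1 (p1 x) (q1 y)) (run P2 (p2 x) (q1 y)) (run P3 (p1 x) (q2 y)) (run P4 (p2 x) (q2 y)) x y}"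
      by (auto simp: good_def)
    then show ?thesis unfolding sum.cartesian_product D_def[symmetric] of_bool_def case_prod_beta'
      using fA by (simp add: sum.If_cases D_def case_prod_beta')
  qed
  ultimately have lower: "16/81 * 4 ^ ?t \<le> (\<Sum>x\<in>?A. \<Sum>y\<in>?A. of_bool (good (run P1 (p1 x) (q1 y)) (run P2 (p2 x) (q1 y))
      (run P3 (p1 x) (q2 y)) (run P4 (p2 x) (q2 y)) x y) :: real)" by simp
  \<comment> \<open>Four protocols with at most 2^d leaves each pay this amount at most 16^d times,
    which adds up to 4/81 of all pairs.\<close>
  let ?K = "?\<beta> * 4 ^ ?t"
  have rect: "(\<Sum>x\<in>S. \<Sum>y\<in>T. of_bool (good z1 z2 z3 z4 x y)) \<le> \<gamma> * real (card S) * real (card T) + ?K"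
    if S: "S \<subseteq> ?A" and T: "T \<subseteq> ?A" for S T z1 z2 z3 z4
  proof (rule ccontr)
    assume "\<not> ?thesis"
    then have big: "(\<Sum>x\<in>S. \<Sum>y\<in>T. of_bool (good z1 z2 z3 z4 x y)) > \<gamma> * real (card S) * real (card T) + ?K" by simp
    have "(\<Sum>x\<in>S. \<Sum>y\<in>T. of_bool (good z1 z2 z3 z4 x y)) \<le> (\<Sum>x\<in>S. \<Sum>y\<in>T. 1 :: real)"
      by (intro sum_mono) auto
    moreover have pos: "0 \<le> \<gamma> * real (card S) * real (card T)" by (simp add: \<gamma>_def)
    ultimately have "?K \<le> real (card S) * real (card T)" using big pos by simp
    moreover have "\<gamma> * real (card S) * real (card T) \<le> (\<Sum>x\<in>S. \<Sum>y\<in>T. of_bool (good z1 z2 z3 z4 x y))"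
    proof -
      have "?K \<ge> 0" by simp
      then show ?thesis using big by linarith
    qed
    \<comment> \<open>With the four outputs fixed, their combination depends on y alone and plays
      the role of \<open>Z\<close>. Each difference of two outputs is off by at most 2 \<epsilon>,
      and the weights N \<beta>1 and N \<beta>2 sum to at most N^2.\<close>
    ultimately have "(\<gamma>/4) ^ 3 * sqrt ?t \<le> 32 * (2 * N\<^sup>2 * \<epsilon> + 1)"
    proof (rule no_dense_approximation_on_large_rectangle[OF U S T, where \<beta>="?\<beta>" and s=s and g=g
          and Z="\<lambda>y. N * (\<beta>1 y * (z1 - z2) - \<beta>2 y * (z3 - z4))", rotated 3])
      fix x y assume "x \<in> S" "y \<in> T" and gd: "good z1 z2 z3 z4 x y"
      then have x: "x \<subseteq> U" and y: "y \<subseteq> U" using S T by auto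
      note b = \<beta>(1,2,3)[OF y]
      define e1 where "e1 = (\<Phi> (p1 x) (q1 y) - z1) - (\<Phi> (p2 x) (q1 y) - z2)"
      define e2 where "e2 = (\<Phi> (p1 x) (q2 y) - z3) - (\<Phi> (p2 x) (q2 y) - z4)"
      have e: "\<bar>e1\<bar> \<le> 2 * \<epsilon>" "\<bar>e2\<bar> \<le> 2 * \<epsilon>" using gd unfolding good_def ok_def e1_def e2_def by linarith+
      have "sgn_ip U x y - s x * g y - N * (\<beta>1 y * (z1 - z2) - \<beta>2 y * (z3 - z4)) = N * (\<beta>1 y * e1 - \<beta>2 y * e2)"
        unfolding ident[OF x y, symmetric] e1_def e2_def by (simp add: algebra_simps)
      also have "\<bar>\<dots>\<bar> = N * \<bar>\<beta>1 y * e1 - \<beta>2 y * e2\<bar>" using N by (simp add: abs_mult)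
      also have "\<dots> \<le> N * (\<beta>1 y * (2 * \<epsilon>) + \<beta>2 y * (2 * \<epsilon>))"
      proof (intro mult_left_mono N)
        have "\<bar>\<beta>1 y * e1\<bar> \<le> \<beta>1 y * (2 * \<epsilon>)" "\<bar>\<beta>2 y * e2\<bar> \<le> \<beta>2 y * (2 * \<epsilon>)"
          using b e by (auto simp: abs_mult intro!: mult_left_mono)
        then show "\<bar>\<beta>1 y * e1 - \<beta>2 y * e2\<bar> \<le> \<beta>1 y * (2 * \<epsilon>) + \<beta>2 y * (2 * \<epsilon>)" by linarith
      qed
      also have "\<dots> = N * ((\<beta>1 y + \<beta>2 y) * (2 * \<epsilon>))" by (simp add: algebra_simps)
      also have "\<dots> \<le> N * (N * (2 * \<epsilon>))"
        using b N \<epsilon> by (intro mult_left_mono mult_right_mono) auto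
      also have "\<dots> = 2 * N\<^sup>2 * \<epsilon>" by (simp add: power2_eq_square)
      finally show "\<bar>sgn_ip U x y - s x * g y - N * (\<beta>1 y * (z1 - z2) - \<beta>2 y * (z3 - z4))\<bar> \<le> 2 * N\<^sup>2 * \<epsilon>" .
    qed (use shatter generic \<epsilon> in \<open>auto simp: \<gamma>_def\<close>)
    then show False using contra by simp
  qed
  note L = run_dense_le_if_rectangles_dense_le[OF fA fA]
  have c: "cost P1 \<le> d" "cost P2 \<le> d" "cost P3 \<le> d" "cost P4 \<le> d" using P1 P2 P3 P4 cost by auto
  have K0: "0 \<le> ?K" "0 \<le> 2 ^ d * ?K" "0 \<le> 2 ^ d * (2 ^ d * ?K)" "0 \<le> 2 ^ d * (2 ^ d * (2 ^ d * ?K))" by simp_all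
  \<comment> \<open>The fixed outputs are replaced by actual runs one at a time. Each replacement
    multiplies the additive term by 2^d and leaves the density term unchanged.\<close>
  have r4: "(\<Sum>x\<in>S. \<Sum>y\<in>T. of_bool (good z1 z2 z3 (run P4 (p2 x) (q2 y)) x y)) \<le> \<gamma> * real (card S) * real (card T) + 2 ^ d * ?K"
    if "S \<subseteq> ?A" "T \<subseteq> ?A" for S T z1 z2 z3
    by (rule L[OF K0(1), where good="\<lambda>z x y. good z1 z2 z3 z x y"]) (use rect that c in auto)
  have r3: "(\<Sum>x\<in>S. \<Sum>y\<in>T. of_bool (good z1 z2 (run P3 (p1 x) (q2 y)) (run P4 (p2 x) (q2 y)) x y)) \<le> \<gamma> * real (card S) * real (card T) + 2 ^ d * (2 ^ d * ?K)"
    if "S \<subseteq> ?A" "T \<subseteq> ?A" for S T z1 z2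
    by (rule L[OF K0(2), where good="\<lambda>z x y. good z1 z2 z (run P4 (p2 x) (q2 y)) x y"]) (use r4 that c in auto)
  have r2: "(\<Sum>x\<in>S. \<Sum>y\<in>T. of_bool (good z1 (run P2 (p2 x) (q1 y)) (run P3 (p1 x) (q2 y)) (run P4 (p2 x) (q2 y)) x y)) \<le> \<gamma> * real (card S) * real (card T) + 2 ^ d * (2 ^ d * (2 ^ d * ?K))"
    if "S \<subseteq> ?A" "T \<subseteq> ?A" for S T z1
    by (rule L[OF K0(3), where good="\<lambda>z x y. good z1 z (run P3 (p1 x) (q2 y)) (run P4 (p2 x) (q2 y)) x y"]) (use r3 that c in auto)
  have "(\<Sum>x\<in>?A. \<Sum>y\<in>?A. of_bool (good (run P1 (p1 x) (q1 y)) (run P2 (p2 x) (q1 y)) (run P3 (p1 x) (q2 y)) (run P4 (p2 x) (q2 y)) x y))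
      \<le> \<gamma> * real (card ?A) * real (card ?A) + 2 ^ d * (2 ^ d * (2 ^ d * (2 ^ d * ?K)))"
    by (rule L[OF K0(4), where good="\<lambda>z x y. good z (run P2 (p2 x) (q1 y)) (run P3 (p1 x) (q2 y)) (run P4 (p2 x) (q2 y)) x y"]) (use r2 c in auto)
  also have "2 ^ d * (2 ^ d * (2 ^ d * (2 ^ d * ?K))) = 4/81 * 4 ^ ?t"
  proof -
    have "(2::real) ^ d * (2 ^ d * (2 ^ d * 2 ^ d)) = 16 ^ d" by (simp flip: power_mult_distrib)
    then have "2 ^ d * (2 ^ d * (2 ^ d * (2 ^ d * ?K))) = 16 ^ d * ?K" by (simp only: mult.assoc[symmetric])
    then show ?thesis by simp
  qed
  also have "\<gamma> * real (card ?A) * real (card ?A) = 8/81 * 4 ^ ?t"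
    using U by (simp add: \<gamma>_def card_Pow flip: power_mult_distrib)
  finally have "16/81 * (4::real) ^ ?t \<le> 12/81 * 4 ^ ?t" using lower by linarith
  then show False by simp
qed

section \<open>Distributed estimation\<close>

lemma ex_pmf_of_weights:
  fixes w :: "nat \<Rightarrow> real"
  assumes "\<And>l. l < k \<Longrightarrow> w l \<ge> 0" "(\<Sum>l<k. w l) = 1"
  shows "\<exists>p. \<forall>l. pmf p l = (if l < k then w l else 0)"
proof -
  let ?w = "\<lambda>l. if l < k then w l else 0"
  have "(\<integral>\<^sup>+ l. ennreal (?w l) \<partial>count_space UNIV) = (\<Sum>l<k. ennreal (?w l))"
    by (rule nn_integral_count_space'[of "{..<k}"]) (auto split: if_splits)
  also have "\<dots> = ennreal (\<Sum>l<k. ?w l)" using assms(1) by (intro sum_ennreal) auto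
  also have "\<dots> = 1" using assms(2) by simp
  finally have "pmf (embed_pmf ?w) l = ?w l" for l
    using assms(1) by (intro pmf_embed_pmf) auto
  then show ?thesis by blast
qed

lemma mean_map_pmf:
  fixes p q :: "nat pmf"
  assumes "\<And>l. pmf p l = (if l < k then w l else 0)" "\<And>l. pmf q l = (if l < k then v l else 0)"
  shows "mean f (map_pmf \<xi> p) (map_pmf \<eta> q) = (\<Sum>l<k. \<Sum>m<k. w l * v m * f (\<xi> l) (\<eta> m))"
proof -
  have sub: "set_pmf p \<subseteq> {..<k}" "set_pmf q \<subseteq> {..<k}" using assms by (auto simp: set_pmf_eq split: if_splits)
  have "pair_pmf (map_pmf \<xi> p) (map_pmf \<eta> q) = map_pmf (\<lambda>(l,m). (\<xi> l, \<eta> m)) (pair_pmf p q)"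
    by (rule map_pair[symmetric])
  then have "mean f (map_pmf \<xi> p) (map_pmf \<eta> q) =
      measure_pmf.expectation (pair_pmf p q) (\<lambda>(l,m). f (\<xi> l) (\<eta> m))"
    unfolding mean_def by (simp add: case_prod_beta')
  also have "\<dots> = (\<Sum>i\<in>{..<k}\<times>{..<k}. (case i of (l,m) \<Rightarrow> f (\<xi> l) (\<eta> m)) * pmf (pair_pmf p q) i)"
    by (rule integral_measure_pmf_real) (use sub in auto)
  also have "\<dots> = (\<Sum>l<k. \<Sum>m<k. w l * v m * f (\<xi> l) (\<eta> m))"
    unfolding sum.cartesian_product by (intro sum.cong refl) (auto simp: pmf_pair assms)
  finally show ?thesis .
qed

section \<open>Choice of the numerical constants\<close>

lemma exponential_beats_power:
  fixes b r :: real
  assumes "0 < r" "r < 1" "b \<ge> 1"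
  obtains C :: nat where "\<And>d m. C * (d + 1) \<le> m \<Longrightarrow> b ^ (d + 1) * r ^ m < 1"
proof -
  obtain C where C: "r ^ C < 1 / b"
    using real_arch_pow_inv[of "1 / b" r] assms by auto
  show ?thesis
  proof (rule that[of C])
    fix d m assume "C * (d + 1) \<le> m"
    then have "r ^ m \<le> (r ^ C) ^ (d + 1)"
      unfolding power_mult[symmetric] using assms by (intro power_decreasing) auto
    also have "\<dots> < (1 / b) ^ (d + 1)"
      using C assms by (intro power_strict_mono) auto
    finally show "b ^ (d + 1) * r ^ m < 1" using assms by (simp add: power_divide field_simps)
  qed
qed

text \<open>The sixteenth root of 16 is about 1.19, and 6/5 is a rational number slightly above
  it.\<close>

lemma sixteen_power_div_le: "(16::real) ^ (n div 16) \<le> (6/5) ^ n"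
proof -
  have "(16::real) ^ (n div 16) \<le> ((6/5) ^ 16) ^ (n div 16)"
    by (intro power_mono) (auto simp: power_divide)
  also have "\<dots> = (6/5) ^ (16 * (n div 16))" by (simp add: power_mult)
  also have "\<dots> \<le> (6/5) ^ n" by (intro power_increasing) auto
  finally show ?thesis .
qed

text \<open>After the estimate by 6/5 the conditions compare exponentials with ratios 51/80 =
  (6/5)(17/16)/2 and 147/160 = (6/5)(49/8)/8. Both are below 1, so a t linear in d + 1 outweighs
  16^d and its cube 4096^d. The exponent d + 1 in place of d lets constant prefactors be absorbed
  into the base.\<close>

lemma low_cost_counting_conditions:
  defines "\<gamma> \<equiv> 8/81 :: real"
  obtains C :: nat where "C \<ge> 1"
    and "\<And>d t. C * (d + 1) \<le> t \<Longrightarrow> 16 ^ (t div 16) * (17/16) ^ t < \<gamma> / 2 * (4/81 / 16 ^ d) * 2 ^ t"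
    and "\<And>d t m. C * (d + 1) \<le> t \<Longrightarrow> t \<le> 16 * m \<Longrightarrow>
        3 * (16 ^ (m div 16) * (49/8) ^ m) < (\<gamma>/4) ^ 3 / 2 * (\<gamma>/4 * (4/81 / 16 ^ d) * 2 ^ m) ^ 3"
proof -
  obtain C1 :: nat where C1: "\<And>d m. C1 * (d + 1) \<le> m \<Longrightarrow> (16 * 81 * 81 / 16 :: real) ^ (d + 1) * (51/80) ^ m < 1"
    using exponential_beats_power[of "51/80 :: real" "16 * 81 * 81 / 16"] by auto
  \<comment> \<open>The constant is 3 divided by the d- and m-free part of the right-hand side,
    where \<gamma>/4 = 2/81.\<close>
  define B :: real where "B = 6 * (81/2) ^ 6 * (81/4) ^ 3"
  have B1: "B \<ge> 1" by (simp add: B_def power_divide)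
  obtain C2 :: nat where C2: "\<And>d m. C2 * (d + 1) \<le> m \<Longrightarrow> (4096 * B) ^ (d + 1) * (147/160) ^ m < 1"
    using exponential_beats_power[of "147/160 :: real" "4096 * B"] B1 by auto
  show ?thesis
  \<comment> \<open>The factor 16 compensates for m being possibly only t/16 in the second
    condition; the summand 1 makes the constant positive.\<close>
  proof (rule that[of "16 * (C1 + C2) + 1"])
    fix d t :: nat assume t: "(16 * (C1 + C2) + 1) * (d + 1) \<le> t"
    have "C1 * (d + 1) \<le> (16 * (C1 + C2) + 1) * (d + 1)" by (intro mult_right_mono) auto
    then have 1: "(16 * 81 * 81 / 16 :: real) ^ (d + 1) * (51/80) ^ t < 1" using C1 t by (meson le_trans)
    have "(16::real) ^ (t div 16) * (17/16) ^ t \<le> (6/5) ^ t * (17/16) ^ t"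
      by (intro mult_right_mono sixteen_power_div_le) auto
    also have "\<dots> = (51/80) ^ t * 2 ^ t" by (simp flip: power_mult_distrib)
    also have "\<dots> < \<gamma> / 2 * (4/81 / 16 ^ d) * 2 ^ t"
    proof (rule mult_strict_right_mono)
      have "(16 :: real) ^ d * (81 * 81 / 16) \<le> 16 ^ d * ((81 * 81 / 16) * (81 * 81 / 16) ^ d)"
        by (intro mult_left_mono) auto
      also have "\<dots> \<le> (16 * 81 * 81 / 16) ^ (d + 1)"
      proof -
        have "(16 * 81 * 81 / 16 :: real) ^ (d + 1) = 16 * (16 ^ d * ((81 * 81 / 16) * (81 * 81 / 16) ^ d))"
          by (simp add: power_mult_distrib[symmetric])
        then show ?thesis by simp
      qed
      finally have "(16 :: real) ^ d * (81 * 81 / 16) * (51/80) ^ t \<le> (16 * 81 * 81 / 16) ^ (d + 1) * (51/80) ^ t"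
        by (intro mult_right_mono) auto
      then have "(16 :: real) ^ d * (81 * 81 / 16) * (51/80) ^ t < 1" using 1 by linarith
      then show "(51/80) ^ t < \<gamma> / 2 * (4/81 / 16 ^ d)" by (simp add: \<gamma>_def field_simps)
    qed simp
    finally show "16 ^ (t div 16) * (17/16) ^ t < \<gamma> / 2 * (4/81 / 16 ^ d) * 2 ^ t" .
  next
    fix d t m :: nat assume t: "(16 * (C1 + C2) + 1) * (d + 1) \<le> t" and m: "t \<le> 16 * m"
    have "16 * (C2 * (d + 1)) \<le> (16 * (C1 + C2) + 1) * (d + 1)"
      unfolding mult.assoc[symmetric] by (intro mult_right_mono) auto
    then have "C2 * (d + 1) \<le> m" using t m by linarith
    then have 2: "(4096 * B) ^ (d + 1) * (147/160) ^ m < 1" using C2 by blast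
    have "B * 4096 ^ d \<le> (4096 * B) ^ (d + 1)"
    proof -
      have "1 * (B * 4096 ^ d) \<le> (4096 * B ^ d) * (B * 4096 ^ d)"
      proof (rule mult_right_mono)
        have "1 \<le> B ^ d" using B1 by (rule one_le_power)
        then show "1 \<le> 4096 * B ^ d" by linarith
      qed (use B1 in simp)
      then show ?thesis by (simp add: power_mult_distrib mult_ac)
    qed
    then have "B * 4096 ^ d * (147/160) ^ m \<le> (4096 * B) ^ (d + 1) * (147/160) ^ m"
      by (intro mult_right_mono) auto
    then have 3: "B * 4096 ^ d * (147/160) ^ m < 1" using 2 by linarith
    have "3 * ((16::real) ^ (m div 16) * (49/8) ^ m) \<le> 3 * ((6/5) ^ m * (49/8) ^ m)"
      by (intro mult_left_mono mult_right_mono sixteen_power_div_le) auto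
    also have "\<dots> = 3 * (147/160) ^ m * 8 ^ m" by (simp flip: power_mult_distrib)
    also have "\<dots> < 3 / (B * 4096 ^ d) * 8 ^ m"
      using 3 B1 by (intro mult_strict_right_mono) (auto simp: field_simps)
    also have "\<dots> = (\<gamma>/4) ^ 3 / 2 * (\<gamma>/4 * (4/81 / 16 ^ d) * 2 ^ m) ^ 3"
    proof -
      have a: "((2::real) ^ m) ^ 3 = 8 ^ m" "((16::real) ^ d) ^ 3 = 4096 ^ d"
        by (simp_all add: power3_eq_cube flip: power_mult_distrib)
      show ?thesis unfolding power_mult_distrib power_divide a by (simp add: \<gamma>_def B_def power_divide)
    qed
    finally show "3 * (16 ^ (m div 16) * (49/8) ^ m) < (\<gamma>/4) ^ 3 / 2 * (\<gamma>/4 * (4/81 / 16 ^ d) * 2 ^ m) ^ 3" .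
  qed simp
qed

section \<open>From sign vectors to input distributions\<close>

lemma sum_abs_le_sqrt:
  fixes v :: "nat \<Rightarrow> real"
  shows "(\<Sum>l<k. \<bar>v l\<bar>) \<le> sqrt (real k * (\<Sum>l<k. (v l)\<^sup>2))"
proof (rule real_le_rsqrt)
  have "(\<Sum>l<k. \<bar>v l\<bar> * 1)\<^sup>2 \<le> (\<Sum>l<k. \<bar>v l\<bar>\<^sup>2) * (\<Sum>l<k. 1\<^sup>2)"
    by (rule Cauchy_Schwarz_ineq_sum)
  then show "(\<Sum>l<k. \<bar>v l\<bar>)\<^sup>2 \<le> real k * (\<Sum>l<k. (v l)\<^sup>2)" by (simp add: mult.commute)
qed

text \<open>Orthogonality removes the cross terms, so all sign patterns give the same norm. With
  weights 1/\<sigma>_i it is \<lambda>_t, and Cauchy-Schwarz over the k coordinates turns it into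
  the square of N, namely k \<lambda>_t.\<close>

lemma sum_squares_sgn_combination:
  fixes a :: "nat \<Rightarrow> nat \<Rightarrow> real"
  assumes "\<And>i j. i < t \<Longrightarrow> j < t \<Longrightarrow> (\<Sum>l<k. a i l * a j l) = (if i = j then \<omega> i else 0)"
  shows "(\<Sum>l<k. (\<Sum>i<t. sgn_vec x i * a i l)\<^sup>2) = (\<Sum>i<t. \<omega> i)"
proof -
  have "(\<Sum>l<k. (\<Sum>i<t. sgn_vec x i * a i l)\<^sup>2) =
      (\<Sum>l<k. \<Sum>i<t. \<Sum>j<t. sgn_vec x i * sgn_vec x j * (a i l * a j l))"
    by (simp add: power2_eq_square sum_product mult_ac)
  also have "\<dots> = (\<Sum>i<t. \<Sum>l<k. \<Sum>j<t. sgn_vec x i * sgn_vec x j * (a i l * a j l))"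
    by (rule sum.swap)
  also have "\<dots> = (\<Sum>i<t. \<Sum>j<t. \<Sum>l<k. sgn_vec x i * sgn_vec x j * (a i l * a j l))"
    by (intro sum.cong refl sum.swap)
  also have "\<dots> = (\<Sum>i<t. \<Sum>j<t. if i = j then sgn_vec x i * sgn_vec x i * \<omega> i else 0)"
    by (intro sum.cong refl) (simp add: sum_distrib_left[symmetric] assms)
  also have "\<dots> = (\<Sum>i<t. sgn_vec x i * sgn_vec x i * \<omega> i)" by simp
  also have "\<dots> = (\<Sum>i<t. \<omega> i)" by (intro sum.cong) (auto simp: sgn_vec_def)
  finally show ?thesis .
qed

lemma bilinear_sgn_combination:
  fixes a b :: "nat \<Rightarrow> nat \<Rightarrow> real" and A :: "nat \<Rightarrow> nat \<Rightarrow> real"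
  assumes "\<And>i j. i < t \<Longrightarrow> j < t \<Longrightarrow> (\<Sum>l<k. \<Sum>m<k. a i l * A l m * b j m) = (if i = j then 1 else 0)"
  shows "(\<Sum>l<k. \<Sum>m<k. (\<Sum>i<t. sgn_vec x i * a i l) * (\<Sum>j<t. sgn_vec y j * b j m) * A l m) = sgn_ip {..<t} x y"
proof -
  have "(\<Sum>l<k. \<Sum>m<k. (\<Sum>i<t. sgn_vec x i * a i l) * (\<Sum>j<t. sgn_vec y j * b j m) * A l m) =
      (\<Sum>l<k. \<Sum>m<k. \<Sum>i<t. \<Sum>j<t. sgn_vec x i * sgn_vec y j * (a i l * A l m * b j m))"
    unfolding sum_product unfolding sum_distrib_right by (intro sum.cong refl) (simp add: mult_ac)
  also have "\<dots> = (\<Sum>l<k. \<Sum>i<t. \<Sum>m<k. \<Sum>j<t. sgn_vec x i * sgn_vec y j * (a i l * A l m * b j m))"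
    by (intro sum.cong refl sum.swap)
  also have "\<dots> = (\<Sum>i<t. \<Sum>l<k. \<Sum>m<k. \<Sum>j<t. sgn_vec x i * sgn_vec y j * (a i l * A l m * b j m))"
    by (rule sum.swap)
  also have "\<dots> = (\<Sum>i<t. \<Sum>l<k. \<Sum>j<t. \<Sum>m<k. sgn_vec x i * sgn_vec y j * (a i l * A l m * b j m))"
    by (intro sum.cong refl sum.swap)
  also have "\<dots> = (\<Sum>i<t. \<Sum>j<t. \<Sum>l<k. \<Sum>m<k. sgn_vec x i * sgn_vec y j * (a i l * A l m * b j m))"
    by (intro sum.cong refl sum.swap)
  also have "\<dots> = (\<Sum>i<t. \<Sum>j<t. if i = j then sgn_vec x i * sgn_vec y i else 0)"
    by (intro sum.cong refl) (simp add: sum_distrib_left[symmetric] assms)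
  also have "\<dots> = sgn_ip {..<t} x y" by (simp add: sgn_ip_def)
  finally show ?thesis .
qed

text \<open>Distributions on the index set are pushed forward along \<xi> and \<eta>, so repeated
  points among the realizing inputs are harmless: the mean is still the bilinear form of
  \<open>A\<close> in the weights.\<close>

lemma estimation_error_bound:
  fixes f :: "'x \<Rightarrow> 'y \<Rightarrow> real" and A :: "real mat" and \<epsilon> :: real
  defines "\<gamma> \<equiv> 8/81 :: real"
  assumes A: "A \<in> carrier_mat k k" and real: "realizes X Y f k A"
    and t1: "1 \<le> t" and t: "t \<le> vec_space.rank k A" and \<epsilon>: "\<epsilon> > 0"
    and est: "estimates \<epsilon> X Y f M" and cost: "\<And>P. P \<in> space M \<Longrightarrow> cost P \<le> d"
    and shatter: "16 ^ (t div 16) * (17/16) ^ t < \<gamma> / 2 * (4/81 / 16 ^ d) * 2 ^ t"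
    and generic: "\<And>m. t \<le> 16 * m \<Longrightarrow>
        3 * (16 ^ (m div 16) * (49/8) ^ m) < (\<gamma>/4) ^ 3 / 2 * (\<gamma>/4 * (4/81 / 16 ^ d) * 2 ^ m) ^ 3"
  shows "(\<gamma>/4) ^ 3 * sqrt t \<le> 32 * (2 * (\<epsilon> * k * inv_singular_sum t A) + 1)"
proof -
  obtain \<xi> \<eta> where \<xi>: "\<And>l. l < k \<Longrightarrow> \<xi> l \<in> X" and \<eta>: "\<And>l. l < k \<Longrightarrow> \<eta> l \<in> Y"
    and Af: "\<And>l m. l < k \<Longrightarrow> m < k \<Longrightarrow> A $$ (l, m) = f (\<xi> l) (\<eta> m)"
    using real unfolding realizes_def by blast
  define \<sigma> where "\<sigma> i = singular_values A ! i" for i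
  obtain a b :: "nat \<Rightarrow> nat \<Rightarrow> real"
    where dual: "\<And>i j. i < t \<Longrightarrow> j < t \<Longrightarrow> (\<Sum>l<k. \<Sum>m<k. a i l * A $$ (l,m) * b j m) = (if i = j then 1 else 0)"
    and aa: "\<And>i j. i < t \<Longrightarrow> j < t \<Longrightarrow> (\<Sum>l<k. a i l * a j l) = (if i = j then 1 / \<sigma> i else 0)"
    and bb: "\<And>i j. i < t \<Longrightarrow> j < t \<Longrightarrow> (\<Sum>l<k. b i l * b j l) = (if i = j then 1 / \<sigma> i else 0)"
    and "\<And>i j. i \<le> j \<Longrightarrow> j < t \<Longrightarrow> \<sigma> j \<le> \<sigma> i"
    and pos: "\<And>i. i < t \<Longrightarrow> \<sigma> i > 0"
    using dual_bases_of_singular_values[OF A t, folded \<sigma>_def] by blast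
  define L where "L = inv_singular_sum t A"
  have L: "L = (\<Sum>i<t. 1 / \<sigma> i)" by (simp add: L_def inv_singular_sum_def \<sigma>_def)
  have Lpos: "L > 0" unfolding L by (rule sum_pos) (use t1 pos in \<open>auto simp: lessThan_empty_iff\<close>)
  have k: "k > 0" using t1 t vec_space.rank_le_nc[OF A] by simp
  define N where "N = sqrt (real k * L)"
  have Npos: "N > 0" using k Lpos by (simp add: N_def)
  define av where "av x l = (\<Sum>i<t. sgn_vec x i * a i l)" for x l
  define bv where "bv y l = (\<Sum>i<t. sgn_vec y i * b i l)" for y l
  have av1: "(\<Sum>l<k. \<bar>av x l\<bar>) \<le> N" for x
    using sum_abs_le_sqrt[of "av x" k] sum_squares_sgn_combination[OF aa, where x=x] unfolding N_def L av_def by simp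
  have bv1: "(\<Sum>l<k. \<bar>bv y l\<bar>) \<le> N" for y
    using sum_abs_le_sqrt[of "bv y" k] sum_squares_sgn_combination[OF bb, where x=y] unfolding N_def L bv_def by simp
  have ip: "(\<Sum>l<k. \<Sum>m<k. av x l * bv y m * A $$ (l,m)) = sgn_ip {..<t} x y" for x y
    unfolding av_def bv_def by (rule bilinear_sgn_combination[where A="\<lambda>l m. A $$ (l,m)"]) (rule dual)
  define pm where "pm w = (SOME p. \<forall>l. pmf p l = (if l < k then w l else 0))" for w :: "nat \<Rightarrow> real"
  have pm: "pmf (pm w) l = (if l < k then w l else 0)" if "\<And>l. l < k \<Longrightarrow> w l \<ge> 0" "(\<Sum>l<k. w l) = 1" for w l
    using someI_ex[OF ex_pmf_of_weights[of k w, OF that]] unfolding pm_def by blast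
  \<comment> \<open>The missing mass is put on coordinate 0 for both signs. In the difference of the
    two distributions, scaled by \<open>N\<close>, only the difference of the masses remains
    there.\<close>
  define wa where "wa v l = (max (v l) 0 + (if l = 0 then N - (\<Sum>i<k. max (v i) 0) else 0)) / N" for v :: "nat \<Rightarrow> real" and l
  define mass where "mass v = (\<Sum>i<k. max (v i) 0)" for v :: "nat \<Rightarrow> real"
  \<comment> \<open>Bob normalises by his own mass. If that mass is 0 the point mass at 0 is a
    default value, which enters later sums only with coefficient \<open>mass v\<close>.\<close>
  define wb where "wb v l = (if mass v = 0 then (if l = 0 then 1 else 0) else max (v l) 0 / mass v)" for v l
  have mass_nn: "mass v \<ge> 0" for v unfolding mass_def by (intro sum_nonneg) auto
  have massN: "mass v \<le> N" if "(\<Sum>l<k. \<bar>v l\<bar>) \<le> N" for v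
  proof -
    have "mass v \<le> (\<Sum>l<k. \<bar>v l\<bar>)" unfolding mass_def by (intro sum_mono) auto
    then show ?thesis using that by linarith
  qed
  have wa_pm: "pmf (pm (wa v)) l = (if l < k then wa v l else 0)" if v: "(\<Sum>l<k. \<bar>v l\<bar>) \<le> N" for v l
  proof (rule pm)
    have "wa v l = (max (v l) 0 + (if l = 0 then N - mass v else 0)) / N" for l
      by (simp add: wa_def mass_def)
    then show "0 \<le> wa v l" for l using massN[OF v] Npos by simp
    have "(\<Sum>l<k. wa v l) = (mass v + (\<Sum>l<k. if l = 0 then N - mass v else 0)) / N"
      unfolding wa_def mass_def by (simp add: sum_divide_distrib[symmetric] sum.distrib)
    also have "(\<Sum>l<k. if l = 0 then N - mass v else 0) = N - mass v" using k by simp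
    finally show "(\<Sum>l<k. wa v l) = 1" using Npos by simp
  qed
  have wb_pm: "pmf (pm (wb v)) l = (if l < k then wb v l else 0)" for v l
  proof (rule pm)
    show "0 \<le> wb v l" for l using mass_nn[of v] by (simp add: wb_def)
    show "(\<Sum>l<k. wb v l) = 1"
    proof (cases "mass v = 0")
      case True
      then show ?thesis using k by (simp add: wb_def)
    next
      case False
      then have "(\<Sum>l<k. wb v l) = (\<Sum>l<k. max (v l) 0) / mass v" by (simp add: wb_def sum_divide_distrib)
      then show ?thesis using False by (simp add: mass_def)
    qed
  qed
  have mass_wb: "mass v * wb v l = max (v l) 0" if "l < k" for v l
  proof (cases "mass v = 0")
    case True
    then have "max (v l) 0 = 0" using that unfolding mass_def by (subst (asm) sum_nonneg_eq_0_iff) auto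
    then show ?thesis using True by simp
  qed (simp add: wb_def)
  let ?neg = "\<lambda>v l. - v l :: real"
  define p1 where "p1 x = map_pmf \<xi> (pm (wa (av x)))" for x
  define p2 where "p2 x = map_pmf \<xi> (pm (wa (?neg (av x))))" for x
  define q1 where "q1 y = map_pmf \<eta> (pm (wb (bv y)))" for y
  define q2 where "q2 y = map_pmf \<eta> (pm (wb (?neg (bv y))))" for y
  have nav: "(\<Sum>l<k. \<bar>?neg (av x) l\<bar>) \<le> N" for x using av1[of x] by simp
  note wp = wa_pm[OF av1] wa_pm[OF nav] wb_pm
  define bil where "bil u v = (\<Sum>l<k. \<Sum>m<k. u l * v m * A $$ (l,m))" for u v
  have mean: "mean f (map_pmf \<xi> (pm u)) (map_pmf \<eta> (pm v)) = bil u v"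
    if "\<And>l. pmf (pm u) l = (if l < k then u l else 0)" "\<And>l. pmf (pm v) l = (if l < k then v l else 0)" for u v
    unfolding mean_map_pmf[OF that] bil_def by (intro sum.cong refl) (simp add: Af)
  have means: "mean f (p1 x) (q1 y) = bil (wa (av x)) (wb (bv y))" "mean f (p2 x) (q1 y) = bil (wa (?neg (av x))) (wb (bv y))"
    "mean f (p1 x) (q2 y) = bil (wa (av x)) (wb (?neg (bv y)))" "mean f (p2 x) (q2 y) = bil (wa (?neg (av x))) (wb (?neg (bv y)))" for x y
    unfolding p1_def p2_def q1_def q2_def by (intro mean wp)+
  have bil4: "N * (c1 * (bil u1 v1 - bil u2 v1) - c2 * (bil u1 v2 - bil u2 v2))
      = bil (\<lambda>l. N * u1 l - N * u2 l) (\<lambda>m. c1 * v1 m - c2 * v2 m)" for c1 c2 u1 u2 v1 v2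
    unfolding bil_def sum_distrib_left sum_subtractf[symmetric]
    by (intro sum.cong refl) (simp add: algebra_simps)
  \<comment> \<open>The coordinate sum of \<open>av x\<close> is the mass of its positive part minus
    that of its negative part, that is, the error made by padding. It pairs with row 0 of
    \<open>A\<close> applied to \<open>bv y\<close>, which is \<open>g y\<close>.\<close>
  define s where "s x = (\<Sum>l<k. av x l)" for x
  define g where "g y = (\<Sum>m<k. bv y m * A $$ (0,m))" for y
  have set_pm: "set_pmf (pm w) \<subseteq> {..<k}" if "\<And>l. pmf (pm w) l = (if l < k then w l else 0)" for w
    using that by (auto simp: set_pmf_eq split: if_splits)
  have supp: "set_pmf (p1 x) \<subseteq> X" "set_pmf (p2 x) \<subseteq> X" "set_pmf (q1 x) \<subseteq> Y" "set_pmf (q2 x) \<subseteq> Y" for x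
    unfolding p1_def p2_def q1_def q2_def set_map_pmf
    using set_pm[OF wp(1), of x] set_pm[OF wp(2), of x] set_pm[OF wp(3)] \<xi> \<eta> by blast+
  have M: "prob_space M" using est by (simp add: estimates_def)
  have "(\<gamma>/4) ^ 3 * sqrt (card {..<t}) \<le> 32 * (2 * N\<^sup>2 * \<epsilon> + 1)"
    unfolding \<gamma>_def
  proof (rule communication_bound[OF M, where ?p1.0=p1 and ?p2.0=p2 and ?q1.0=q1 and ?q2.0=q2 and \<Phi>="mean f"
        and ?\<beta>1.0="\<lambda>y. mass (bv y)" and ?\<beta>2.0="\<lambda>y. mass (?neg (bv y))" and s=s and g=g and d=d])
    fix x y :: "nat set" and p q assume "p \<in> {p1 x, p2 x}" "q \<in> {q1 y, q2 y}"
    then have "set_pmf p \<subseteq> X" "set_pmf q \<subseteq> Y" using supp[of x] supp[of y] by auto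
    then show "{P \<in> space M. \<bar>run P p q - mean f p q\<bar> \<le> \<epsilon>} \<in> sets M \<and>
        measure M {P \<in> space M. \<bar>run P p q - mean f p q\<bar> \<le> \<epsilon>} \<ge> 2/3"
      using est unfolding estimates_def by blast
  next
    fix y :: "nat set"
    have "mass (bv y) + mass (?neg (bv y)) = (\<Sum>l<k. \<bar>bv y l\<bar>)"
      unfolding mass_def sum.distrib[symmetric] by (intro sum.cong) auto
    then show "mass (bv y) + mass (?neg (bv y)) \<le> N" using bv1[of y] by simp
  next
    fix x y :: "nat set"
    have ua: "N * wa (av x) l - N * wa (?neg (av x)) l = av x l - (if l = 0 then s x else 0)" if "l < k" for l
    proof -
      have "(\<Sum>i<k. max (av x i) 0) - (\<Sum>i<k. max (- av x i) 0) = s x"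
        unfolding s_def sum_subtractf[symmetric] by (intro sum.cong) auto
      then show ?thesis using Npos by (auto simp: wa_def)
    qed
    have ub: "mass (bv y) * wb (bv y) m - mass (?neg (bv y)) * wb (?neg (bv y)) m = bv y m" if "m < k" for m
      using mass_wb[OF that, of "bv y"] mass_wb[OF that, of "?neg (bv y)"] by auto
    have "N * (mass (bv y) * (mean f (p1 x) (q1 y) - mean f (p2 x) (q1 y))
         - mass (?neg (bv y)) * (mean f (p1 x) (q2 y) - mean f (p2 x) (q2 y)))
       = (\<Sum>l<k. \<Sum>m<k. (av x l - (if l = 0 then s x else 0)) * bv y m * A $$ (l,m))"
      unfolding means bil4 unfolding bil_def by (intro sum.cong refl) (simp add: ua ub)
    also have "\<dots> = (\<Sum>l<k. \<Sum>m<k. av x l * bv y m * A $$ (l,m)) - (\<Sum>l<k. if l = 0 then s x * g y else 0)"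
      unfolding sum_subtractf[symmetric] g_def
      by (intro sum.cong refl) (auto simp: sum_distrib_left sum_subtractf algebra_simps)
    also have "\<dots> = sgn_ip {..<t} x y - s x * g y" using k by (simp add: ip)
    finally show "N * (mass (bv y) * (mean f (p1 x) (q1 y) - mean f (p2 x) (q1 y))
         - mass (?neg (bv y)) * (mean f (p1 x) (q2 y) - mean f (p2 x) (q2 y))) = sgn_ip {..<t} x y - s x * g y" .
  qed (use Npos \<epsilon> cost mass_nn shatter generic in \<open>auto simp: \<gamma>_def\<close>)
  moreover have "N\<^sup>2 = real k * L" using Lpos by (simp add: N_def)
  ultimately show ?thesis by (simp add: L_def mult_ac)
qed

text \<open>Singular values decrease, so each of the first t' reciprocals is at most each later one
  and averages of initial segments grow. Lowering t to t' thus shrinks \<lambda> at least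
  proportionally.\<close>

lemma inv_singular_sum_mono_average:
  assumes A: "A \<in> carrier_mat k k" and t: "t \<le> vec_space.rank k A" and t': "t' \<le> t"
  shows "real t * inv_singular_sum t' A \<le> real t' * inv_singular_sum t A"
proof -
  define \<sigma> where "\<sigma> i = singular_values A ! i" for i
  have mono: "\<And>i j. i \<le> j \<Longrightarrow> j < t \<Longrightarrow> \<sigma> j \<le> \<sigma> i" and pos: "\<And>i. i < t \<Longrightarrow> \<sigma> i > 0"
    by (rule dual_bases_of_singular_values[OF A t, folded \<sigma>_def], blast)+
  let ?h = "\<lambda>i. 1 / \<sigma> i"
  have split: "(\<Sum>i<t. ?h i) = (\<Sum>i<t'. ?h i) + (\<Sum>i\<in>{t'..<t}. ?h i)"
    using sum.union_disjoint[of "{..<t'}" "{t'..<t}" ?h] t' by (simp add: ivl_disj_un ivl_disj_int)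
  have "real (t - t') * (\<Sum>i<t'. ?h i) = (\<Sum>j\<in>{t'..<t}. \<Sum>i<t'. ?h i)" by simp
  also have "\<dots> \<le> (\<Sum>j\<in>{t'..<t}. \<Sum>i<t'. ?h j)"
  proof (intro sum_mono)
    fix j i assume "j \<in> {t'..<t}" "i \<in> {..<t'}"
    then have "\<sigma> j \<le> \<sigma> i" "\<sigma> j > 0" using mono[of i j] pos[of j] by auto
    then show "1 / \<sigma> i \<le> 1 / \<sigma> j" by (intro divide_left_mono) auto
  qed
  also have "\<dots> = real t' * (\<Sum>j\<in>{t'..<t}. ?h j)" by (simp add: sum_distrib_left)
  finally have "real (t - t') * (\<Sum>i<t'. ?h i) \<le> real t' * (\<Sum>j\<in>{t'..<t}. ?h j)" .
  moreover have "real t * (\<Sum>i<t'. ?h i) = real t' * (\<Sum>i<t'. ?h i) + real (t - t') * (\<Sum>i<t'. ?h i)"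
    using t' by (simp add: of_nat_diff left_diff_distrib)
  moreover have "real t' * (\<Sum>i<t. ?h i) = real t' * (\<Sum>i<t'. ?h i) + real t' * (\<Sum>j\<in>{t'..<t}. ?h j)"
    unfolding split by (rule distrib_left)
  ultimately show ?thesis
    unfolding inv_singular_sum_def \<sigma>_def[symmetric] by linarith
qed

lemma inv_singular_sum_pos:
  assumes A: "A \<in> carrier_mat k k" and t: "t \<le> vec_space.rank k A" "1 \<le> t"
  shows "inv_singular_sum t A > 0"
proof -
  have pos: "\<And>i. i < t \<Longrightarrow> singular_values A ! i > 0"
    by (rule dual_bases_of_singular_values[OF A t(1)]) blast
  show ?thesis unfolding inv_singular_sum_def
    by (rule sum_pos) (use pos t in \<open>auto simp: lessThan_empty_iff\<close>)
qed

theorem theorem4p5: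
  "\<exists>c::real. c > 0 \<and>
     (\<forall>(X :: 'x set) (Y :: 'y set) (f :: 'x \<Rightarrow> 'y \<Rightarrow> real) (k :: nat) (A :: real mat)
        (t :: nat) (\<epsilon> :: real).
        (\<forall>x\<in>X. \<forall>y\<in>Y. f x y \<in> {-1..1}) \<longrightarrow>
        A \<in> carrier_mat k k \<longrightarrow>
        (\<forall>i<k. \<forall>j<k. A $$ (i, j) \<in> {-1..1}) \<longrightarrow>
        realizes X Y f k A \<longrightarrow>
        1 \<le> t \<longrightarrow> t \<le> vec_space.rank k A \<longrightarrow>
        \<epsilon> > 0 \<longrightarrow>
        ereal (c * min (real t) ((real t)\<^sup>2 / (\<epsilon>\<^sup>2 * (real k)\<^sup>2 * (inv_singular_sum t A)\<^sup>2)))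
          \<le> max 1 (ereal_of_enat (dist_est_complexity \<epsilon> X Y f)))"
proof -
  obtain C :: nat where C1: "C \<ge> 1"
    and shatter: "\<And>d t. C * (d + 1) \<le> t \<Longrightarrow> 16 ^ (t div 16) * (17/16) ^ t < (8/81 :: real) / 2 * (4/81 / 16 ^ d) * 2 ^ t"
    and generic: "\<And>d t m. C * (d + 1) \<le> t \<Longrightarrow> t \<le> 16 * m \<Longrightarrow>
        3 * (16 ^ (m div 16) * (49/8) ^ m) < ((8/81 :: real)/4) ^ 3 / 2 * ((8/81)/4 * (4/81 / 16 ^ d) * 2 ^ m) ^ 3"
    using low_cost_counting_conditions by blast
  define \<kappa> :: real where "\<kappa> = (8/81/4) ^ 3"
  have \<kappa>: "0 < \<kappa>" "\<kappa> \<le> 1" by (simp_all add: \<kappa>_def power_divide)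
  \<comment> \<open>With the error scale at most \<kappa>/256 times sqrt t', the error bound becomes
    \<kappa> sqrt t' \<le> \<kappa> sqrt t' / 4 + 32, which is impossible once sqrt t' exceeds
    64/\<kappa>. The next constant is chosen to have square root \<kappa>/256.\<close>
  define T :: real where "T = (64 / \<kappa>)\<^sup>2"
  define \<eta> :: real where "\<eta> = (\<kappa> / 256)\<^sup>2"
  have "1 \<le> 64 / \<kappa>" using \<kappa> by (simp add: field_simps)
  then have T: "T \<ge> 1" unfolding T_def by (rule one_le_power)
  have \<eta>: "0 < \<eta>" "\<eta> \<le> 1" using \<kappa> by (simp_all add: \<eta>_def power_le_one)
  \<comment> \<open>The first entry brings the bound down to 1 when the minimum is at most (T +
    1)/\<eta>. The second combines the loss \<eta>/2 from choosing t' with the factor 2 C from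
    \<open>core\<close>.\<close>
  define c where "c = min (\<eta> / (T + 1)) (\<eta> / (4 * C))"
  have c0: "c > 0" using \<eta> T C1 by (simp add: c_def)
  have core: "real t' \<le> 2 * C * max 1 (real d)"
    if est: "estimates \<epsilon> X Y f M" and cost: "\<forall>P\<in>space M. cost P \<le> d"
      and A: "A \<in> carrier_mat k k" and re: "realizes X Y f k A" and t: "t' \<le> vec_space.rank k A"
      and \<epsilon>: "\<epsilon> > 0" and big: "real t' > T" and small: "\<epsilon> * k * inv_singular_sum t' A \<le> \<kappa> / 256 * sqrt t'"
    for X :: "'x set" and Y :: "'y set" and f k A t' \<epsilon> M d
  proof (rule ccontr)
    assume neg: "\<not> real t' \<le> 2 * C * max 1 (real d)"
    have "real (C * (d + 1)) \<le> real C * (2 * max 1 (real d))"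
      unfolding of_nat_mult by (intro mult_left_mono) auto
    then have cd: "C * (d + 1) \<le> t'" using neg by linarith
    have t1: "1 \<le> t'" using big T by linarith
    have "\<kappa> * sqrt t' \<le> 32 * (2 * (\<epsilon> * k * inv_singular_sum t' A) + 1)"
      unfolding \<kappa>_def
      by (rule estimation_error_bound[OF A re t1 t \<epsilon> est, where d=d])
        (use cost shatter[OF cd] generic[OF cd] in auto)
    then have "\<kappa> * sqrt t' \<le> \<kappa> * sqrt t' / 4 + 32" using small by simp
    then have "sqrt t' \<le> 64 / \<kappa>" using \<kappa> by (simp add: field_simps)
    then have "real t' \<le> T" unfolding T_def using \<kappa> by (metis of_nat_0_le_iff real_sqrt_pow2 real_sqrt_ge_zero power_mono)
    then show False using big by simp
  qed
  show ?thesis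
  proof (intro exI[of _ c] conjI c0 allI impI)
    fix X :: "'x set" and Y :: "'y set" and f :: "'x \<Rightarrow> 'y \<Rightarrow> real" and k A t and \<epsilon> :: real
    assume A: "A \<in> carrier_mat k k" and re: "realizes X Y f k A"
      and t1: "1 \<le> t" and t: "t \<le> vec_space.rank k A" and \<epsilon>: "\<epsilon> > 0"
    define L where "L = inv_singular_sum t A"
    have L: "L > 0" unfolding L_def by (rule inv_singular_sum_pos[OF A t t1])
    have k: "k > 0" using t1 t vec_space.rank_le_nc[OF A] by simp
    define q where "q = (real t)\<^sup>2 / (\<epsilon>\<^sup>2 * (real k)\<^sup>2 * L\<^sup>2)"
    have q: "q > 0" using t1 \<epsilon> k L by (simp add: q_def)
    have sq: "sqrt q = real t / (\<epsilon> * k * L)"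
      using \<epsilon> k L by (simp add: q_def real_sqrt_divide real_sqrt_mult)
    define R where "R = dist_est_complexity \<epsilon> X Y f"
    have "ereal (c * min (real t) q) \<le> max 1 (ereal_of_enat R)"
    proof (cases R)
      case infinity
      then show ?thesis by simp
    next
      case (enat d)
      let ?D = "{enat d | d. \<exists>M. estimates \<epsilon> X Y f M \<and> (\<forall>P\<in>space M. cost P \<le> d)}"
      have "?D \<noteq> {}"
      proof
        assume "?D = {}"
        then have "R = \<infinity>" unfolding R_def dist_est_complexity_def by (simp only: Inf_empty top_enat_def)
        then show False using enat by simp
      qed
      \<comment> \<open>Extended naturals are well-ordered, so the infimum of a nonempty set is
        attained by an actual protocol.\<close>
      then have "Inf ?D \<in> ?D" by (meson wellorder_InfI ex_in_conv)
      then have "enat d \<in> ?D" using enat by (simp add: R_def dist_est_complexity_def)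
      then obtain M where M: "estimates \<epsilon> X Y f M" "\<forall>P\<in>space M. cost P \<le> d" by auto
      have "c * min (real t) q \<le> max 1 (real d)"
      proof (cases "real (min t (nat \<lfloor>\<eta> * q\<rfloor>)) > T")
        case False
        \<comment> \<open>In this range the minimum is bounded by an absolute constant, and the
          alternative 1 in the conclusion absorbs it. The summand 1 accounts for the floor.\<close>
        have "min (real t) q \<le> (T + 1) / \<eta>"
        proof (cases "real t \<le> T")
          case True
          have "T \<le> (T + 1) / \<eta>" using \<eta> T by (simp add: field_simps) (smt (verit) mult_left_le)
          then show ?thesis using True by linarith
        next
          case f2: False
          then have "real (nat \<lfloor>\<eta> * q\<rfloor>) \<le> T" using False by (auto simp: min_def split: if_splits)
          then have "\<eta> * q \<le> T + 1" using \<eta> q by linarith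
          then have "q \<le> (T + 1) / \<eta>" using \<eta> by (simp add: field_simps)
          then show ?thesis by linarith
        qed
        then have "c * min (real t) q \<le> \<eta> / (T + 1) * ((T + 1) / \<eta>)"
          using c0 t1 q T \<eta> by (intro mult_mono) (auto simp: c_def)
        also have "\<dots> = 1" using T \<eta> by simp
        finally show ?thesis by simp
      next
        case True
        \<comment> \<open>As \<lambda>_t / t is nondecreasing, the error scale at t' is at most t' /
          sqrt q. Keeping t' below \<eta> q makes this at most sqrt \<eta> times sqrt t', the
          smallness that \<open>core\<close> asks for.\<close>
        define t' where "t' = min t (nat \<lfloor>\<eta> * q\<rfloor>)"
        have t': "real t' > T" "t' \<le> t" using True by (auto simp: t'_def)
        have t'q: "real t' \<le> \<eta> * q"
        proof -
          have "real t' \<le> real (nat \<lfloor>\<eta> * q\<rfloor>)" by (simp add: t'_def)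
          also have "\<dots> \<le> \<eta> * q" using \<eta> q by (intro of_nat_floor) simp
          finally show ?thesis .
        qed
        \<comment> \<open>Since \<eta> q is at least 1, rounding down loses at most a factor
          2.\<close>
        have t'lower: "real t' \<ge> \<eta> / 2 * min (real t) q"
        proof -
          have "\<eta> * q \<ge> 1" using t'q t' T by linarith
          then have "1 \<le> \<lfloor>\<eta> * q\<rfloor>" by simp
          then have "real (nat \<lfloor>\<eta> * q\<rfloor>) = of_int \<lfloor>\<eta> * q\<rfloor>" "1 \<le> real_of_int \<lfloor>\<eta> * q\<rfloor>" by simp_all
          then have fl: "real (nat \<lfloor>\<eta> * q\<rfloor>) \<ge> \<eta> * q / 2"
            using real_of_int_floor_gt_diff_one[of "\<eta> * q"] by linarith
          have a: "\<eta> / 2 * min (real t) q \<le> 1 * real t" using \<eta> q by (intro mult_mono) auto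
          have b: "\<eta> / 2 * min (real t) q \<le> \<eta> / 2 * q" using \<eta> by (intro mult_left_mono) auto
          have "real t' = min (real t) (real (nat \<lfloor>\<eta> * q\<rfloor>))" by (simp add: t'_def of_nat_min)
          then show ?thesis using a b fl by linarith
        qed
        have "\<epsilon> * k * inv_singular_sum t' A \<le> \<kappa> / 256 * sqrt t'"
        proof -
          have "real t * inv_singular_sum t' A \<le> real t' * L"
            unfolding L_def by (rule inv_singular_sum_mono_average[OF A t t'(2)])
          then have "inv_singular_sum t' A \<le> real t' * L / real t" using t1 by (simp add: field_simps)
          then have "\<epsilon> * k * inv_singular_sum t' A \<le> \<epsilon> * k * (real t' * L / real t)"
            using \<epsilon> by (intro mult_left_mono) auto
          also have "\<dots> = real t' / sqrt q" unfolding sq using t1 \<epsilon> k L by (simp add: field_simps)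
          also have "\<dots> = sqrt t' * (sqrt t' / sqrt q)" by simp
          also have "\<dots> \<le> sqrt t' * sqrt \<eta>"
          proof (intro mult_left_mono)
            have "sqrt t' \<le> sqrt (\<eta> * q)" using t'q by simp
            then show "sqrt t' / sqrt q \<le> sqrt \<eta>" using q by (simp add: real_sqrt_mult field_simps)
          qed simp
          also have "sqrt \<eta> = \<kappa> / 256" using \<kappa> by (simp add: \<eta>_def)
          finally show ?thesis by (simp add: mult.commute)
        qed
        then have "real t' \<le> 2 * C * max 1 (real d)"
          using core[OF M A re] t t' \<epsilon> by simp
        have "c * min (real t) q \<le> \<eta> / (4 * C) * min (real t) q"
          using q by (intro mult_right_mono) (auto simp: c_def)
        also have "\<dots> = (\<eta> / 2 * min (real t) q) / (2 * C)" by simp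
        also have "\<dots> \<le> real t' / (2 * C)" using t'lower by (intro divide_right_mono) auto
        also have "\<dots> \<le> max 1 (real d)"
          using \<open>real t' \<le> 2 * C * max 1 (real d)\<close> C1 by (simp add: field_simps)
        finally show ?thesis .
      qed
      then have "ereal (c * min (real t) q) \<le> ereal (max 1 (real d))" by (simp only: ereal_less_eq(3))
      also have "\<dots> = max 1 (ereal_of_enat R)" unfolding enat by (simp add: max_def one_ereal_def)
      finally show ?thesis .
    qed
    then show "ereal (c * min (real t) ((real t)\<^sup>2 / (\<epsilon>\<^sup>2 * (real k)\<^sup>2 * (inv_singular_sum t A)\<^sup>2)))
        \<le> max 1 (ereal_of_enat (dist_est_complexity \<epsilon> X Y f))"
      by (simp add: q_def L_def R_def)
  qed
qed

end
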